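(* For every $\Gamma\in[1-2^{-12},1[$ there exists a weak static solution $f_\Gamma\in L^1(\mathbb R^3\times\mathbb R^3)$ (of the gravitational Vlasov-Poisson system) whose essential support is $$\mathcal D_\Gamma=\{(x,v)\in\mathbb R^3\times\mathbb R^3:\ -1\le |x\wedge v|^2-|x|^2-|v|^2\le 0,\ |x\wedge v|^2\le\Gamma\}\subset\{(x,v)\in\mathbb R^3\times\mathbb R^3:\ |x|\le 1,\ |v|\le 1\}$$ and which satisfies $$\rho_{f_\Gamma}(x)=\int_{\mathbb R^3}f_\Gamma(x,v)\,dv=\frac{3}{4\pi}\,\mathbf 1_{\overline{B_1(0)}}(x)\quad\text{for a.e. }x\in\mathbb R^3.$$
   Context: $x\wedge v$ is the cross product in $\mathbb R^3$; $\overline{B_1(0)}$ is the closed unit ball; $[a,b[$ denotes a half-open interval. Weak static solution: a function $f\in L^1(\mathbb R^3\times\mathbb R^3)$, $f=f(x,v)\ge0$ a.e., such that (a) there is a compact set $K\subset\mathbb R^3\times\mathbb R^3$ with $f=0$ a.e. outside $K$; (b) $\rho_f(x)=\int_{\mathbb R^3}f(x,v)\,dv$ belongs to $L^\infty(\mathbb R^3)$; (c) with $U_f(x)=-\int_{\mathbb R^3}\frac{\rho_f(y)}{|x-y|}\,dy$ (which is $C^1$ under (a),(b)), $$\int_{\mathbb R^3}\int_{\mathbb R^3}f(x,v)\big(v\cdot\nabla_x\varphi(x,v)-\nabla_xU_f(x)\cdot\nabla_v\varphi(x,v)\big)\,dx\,dv=0$$ for all test functions $\varphi\in C_c^\infty(\mathbb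 R^3\times\mathbb R^3)$. *)

theory Defs
  imports "HOL-Analysis.Analysis"
begin

type_synonym phase = "(real ^ 3) \<times> (real ^ 3)"

text \<open>Only meaningful where \<open>f\<close> is differentiable; the gradient is then unique.\<close>

definition gradient :: "('a::real_inner \<Rightarrow> real) \<Rightarrow> 'a \<Rightarrow> 'a" where
  "gradient f x = (THE D. GDERIV f x :> D)"

primrec Ck :: "nat \<Rightarrow> ('a::euclidean_space \<Rightarrow> real) \<Rightarrow> bool" where
  "Ck 0 f \<longleftrightarrow> continuous_on UNIV f"
| "Ck (Suc k) f \<longleftrightarrow>
    f differentiable_on UNIV \<and> (\<forall>h. Ck k (\<lambda>x. frechet_derivative f (at x) h))"

definition test_function :: "('a::euclidean_space \<Rightarrow> real) \<Rightarrow> bool" where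
  "test_function \<phi> \<longleftrightarrow> (\<forall>k. Ck k \<phi>) \<and> compact (closure {z. \<phi> z \<noteq> 0})"

text \<open>The complement of the largest open set on which \<open>f\<close> vanishes almost everywhere.\<close>

definition essential_support :: "('a::euclidean_space \<Rightarrow> real) \<Rightarrow> 'a set" where
  "essential_support f = - \<Union>{U. open U \<and> (AE z in lborel. z \<in> U \<longrightarrow> f z = 0)}"

definition rho :: "(phase \<Rightarrow> real) \<Rightarrow> real ^ 3 \<Rightarrow> real" where
  "rho f x = (LINT v|lborel. f (x, v))"

definition potential :: "(phase \<Rightarrow> real) \<Rightarrow> real ^ 3 \<Rightarrow> real" where
  "potential f x = - (LINT y|lborel. rho f y / norm (x - y))"

text \<open>
  Elements of \<open>L\<^sup>1\<close> are given by Borel measurable representatives. \<open>lborel\<close> on \<open>phase\<close> is the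
  product Lebesgue measure \<open>dx dv\<close>. By the first four conditions the potential is
  continuously differentiable and the integrand of the last one is integrable, so the Bochner
  integral does not take its default value \<open>0\<close> there.
\<close>

definition weak_static_solution :: "(phase \<Rightarrow> real) \<Rightarrow> bool" where
  "weak_static_solution f \<longleftrightarrow>
     integrable lborel f \<and>
     (AE z in lborel. 0 \<le> f z) \<and>
     (\<exists>K. compact K \<and> (AE z in lborel. z \<notin> K \<longrightarrow> f z = 0)) \<and>
     (\<exists>C. AE x in lborel. \<bar>rho f x\<bar> \<le> C) \<and>
     (\<forall>\<phi>. test_function \<phi> \<longrightarrow>
        (LINT (x, v)|lborel. f (x, v) *
           (v \<bullet> gradient (\<lambda>x'. \<phi> (x', v)) x
            - gradient (potential f) x \<bullet> gradient (\<lambda>v'. \<phi> (x, v')) v)) = 0)"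

definition D :: "real \<Rightarrow> phase set" where
  "D \<Gamma> = {(x, v). -1 \<le> (norm (cross3 x v))\<^sup>2 - (norm x)\<^sup>2 - (norm v)\<^sup>2
               \<and> (norm (cross3 x v))\<^sup>2 - (norm x)\<^sup>2 - (norm v)\<^sup>2 \<le> 0
               \<and> (norm (cross3 x v))\<^sup>2 \<le> \<Gamma>}"

end

theory Submission
  imports Defs
begin

text \<open>
  Inside the unit ball the density \<open>3 / (4 \<pi>)\<close> generates the harmonic force \<open>-x\<close>, whose flow is the
  rotation of phase space through the angle \<open>t\<close>. A density that depends only on the invariants
  \<open>L = |x \<and> v|\<^sup>2\<close> and \<open>Q = 1 - |x|\<^sup>2 - |v|\<^sup>2 + L\<close> of this flow is a weak solution as soon as it
  generates that density. With \<open>u = |x|\<^sup>2\<close>, radial velocity \<open>a\<close> and squared tangential velocity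
  \<open>s\<close> one has \<open>L = u s\<close>, \<open>Q = (1 - u) (1 - s) - a\<^sup>2\<close> and \<open>dv = \<pi> da ds\<close>. For
  \<open>f = 3 / (4 \<pi>\<^sup>3) (W(L) - 2 k(L) Q) / \<surd>Q\<close> on \<open>Q > 0\<close>, \<open>L \<le> \<Gamma>\<close>, integration over \<open>a\<close> reduces the
  requirement on the density to
  \<open>\<integral> (W(L) - k(L) (1 - u) (1 - L / u)) dL = u\<close> over \<open>0 \<le> L \<le> min(u, \<Gamma>)\<close>, for all \<open>0 < u < 1\<close>.
  Every \<open>q\<close> with \<open>q(0) = 1\<close> and \<open>q(\<Gamma>) = q'(\<Gamma>) = 0\<close> gives a solution
  \<open>k = - (2 q' + L q'')\<close>, \<open>W = q - (1 - L) q'\<close>, and \<open>q = 1 - 4 t\<^sup>3 + 3 t\<^sup>4\<close> with \<open>t = L / \<Gamma>\<close> makes \<open>f\<close> positive.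
\<close>

subsection \<open>Lebesgue measure in cylindrical coordinates\<close>

lemma nn_integral_lborel_pair:
  fixes G :: "'a::euclidean_space \<times> 'b::euclidean_space \<Rightarrow> ennreal"
  assumes "G \<in> borel_measurable borel"
  shows "(\<integral>\<^sup>+p. G p \<partial>lborel) = (\<integral>\<^sup>+a. \<integral>\<^sup>+b. G (a, b) \<partial>lborel \<partial>lborel)"
proof -
  have "G \<in> borel_measurable (lborel \<Otimes>\<^sub>M lborel)"
    unfolding lborel_prod using assms by simp
  from lborel.nn_integral_fst[OF this] show ?thesis
    by (simp add: lborel_prod)
qed

text \<open>Lebesgue measure is determined by its values on boxes, and the preimage of a box is its
  image under the inverse map, which is again orthogonal and so preserves volume.\<close>

lemma distr_lborel_orthogonal_transformation:
  fixes T :: "real ^ ('n::{finite,wellorder}) \<Rightarrow> real ^ ('n::{finite,wellorder})"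
  assumes T: "orthogonal_transformation T"
  shows "distr lborel borel T = lborel"
proof (rule lborel_eqI[symmetric])
  have lin: "linear T"
    using T by (rule orthogonal_transformation_linear)
  have meas: "T \<in> borel_measurable borel"
    by (intro borel_measurable_continuous_onI linear_continuous_on)
       (use lin in \<open>simp add: linear_conv_bounded_linear\<close>)
  fix l u :: "(real, 'n) vec"
  assume le: "\<And>b. b \<in> Basis \<Longrightarrow> l \<bullet> b \<le> u \<bullet> b"
  have inv: "orthogonal_transformation (inv T)"
    using T by (rule orthogonal_transformation_inv)
  have vim: "T -` box l u = inv T ` box l u"
    by (simp add: bij_vimage_eq_inv_image orthogonal_transformation_bij T)
  have bm: "T -` box l u \<in> sets borel"
    using measurable_sets[OF meas, of "box l u"] by simp
  have "emeasure (distr lborel borel T) (box l u) = emeasure lborel (T -` box l u)"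
    using meas by (subst emeasure_distr) auto
  also have "\<dots> = emeasure lebesgue (inv T ` box l u)"
    using bm vim by simp
  also have "\<dots> = ennreal (measure lebesgue (box l u))"
    using measurable_orthogonal_image[OF inv, of "box l u"]
      measure_orthogonal_image[OF inv, of "box l u"]
    by (metis emeasure_eq_measure2 lmeasurable_box)
  also have "\<dots> = (\<Prod>b\<in>Basis. (u - l) \<bullet> b)"
    using le by (simp add: measure_completion measure_lborel_box_eq)
  finally show "emeasure (distr lborel borel T) (box l u) = (\<Prod>b\<in>Basis. (u - l) \<bullet> b)" .
qed simp

lemma prod_Basis_cart: "(\<Prod>b\<in>Basis. (x :: real ^ 'n) \<bullet> b) = (\<Prod>i\<in>UNIV. x $ i)"
proof -
  have B: "(Basis :: (real ^ 'n) set) = (\<lambda>i. axis i 1) ` UNIV"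
    by (auto simp: Basis_vec_def)
  have "inj (\<lambda>i :: 'n. axis i (1 :: real))"
    by (auto simp: inj_on_def axis_eq_axis)
  then show ?thesis
    by (simp add: B prod.reindex inner_axis)
qed

text \<open>Makes iterated integration available on \<open>real ^ 3\<close>. Preimages of boxes are
  products of three intervals.\<close>

lemma distr_lborel_vector_3:
  "distr lborel borel (\<lambda>(a, b, c). vector [a, b, c]) = (lborel :: (real ^ 3) measure)"
proof (rule lborel_eqI[symmetric])
  let ?V = "\<lambda>(a, b, c). vector [a, b, c] :: real ^ 3"
  have V: "?V p = fst p *\<^sub>R axis 1 1 + fst (snd p) *\<^sub>R axis 2 1 + snd (snd p) *\<^sub>R axis 3 1" for p
    by (cases p) (auto simp: vec_eq_iff forall_3 axis_def)
  have meas: "?V \<in> borel_measurable borel"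
    unfolding V by (intro borel_measurable_continuous_onI continuous_intros)
  fix l u :: "real ^ 3"
  assume "\<And>b. b \<in> Basis \<Longrightarrow> l \<bullet> b \<le> u \<bullet> b"
  then have le: "l $ i \<le> u $ i" for i
    by (metis axis_in_Basis_iff inner_axis inner_real_def mult.right_neutral Basis_real_def insertI1)
  have vim: "?V -` box l u = {l$1<..<u$1} \<times> {l$2<..<u$2} \<times> {l$3<..<u$3}"
    by (auto simp: mem_box_cart forall_3)
  have "emeasure (distr lborel borel ?V) (box l u) = emeasure lborel (?V -` box l u)"
    using meas by (subst emeasure_distr) auto
  also have "\<dots> = ennreal (u$1 - l$1) * (ennreal (u$2 - l$2) * ennreal (u$3 - l$3))"
  proof -
    have pr: "emeasure lborel (A \<times> B) = emeasure lborel A * emeasure lborel B"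
      if "A \<in> sets borel" "B \<in> sets borel" for A :: "'x::euclidean_space set" and B :: "'y::euclidean_space set"
      using lborel.emeasure_pair_measure_Times[of A lborel B] that by (simp add: lborel_prod)
    show ?thesis
      unfolding vim using le by (simp add: pr borel_Times)
  qed
  also have "\<dots> = (\<Prod>b\<in>Basis. (u - l) \<bullet> b)"
  proof -
    have "(\<Prod>i\<in>UNIV. (u - l) $ i) = (u$1 - l$1) * ((u$2 - l$2) * (u$3 - l$3))"
      unfolding UNIV_3 by simp
    then show ?thesis
      unfolding prod_Basis_cart
      by (simp only: ennreal_mult' diff_ge_0_iff_ge le)
  qed
  finally show "emeasure (distr lborel borel ?V) (box l u) = (\<Prod>b\<in>Basis. (u - l) \<bullet> b)" .
qed simp

text \<open>Polar coordinates in the squared radius: the disc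
  \<open>(norm w)\<^sup>2 \<le> a\<close> has area \<open>pi * a\<close>, linear in
  \<open>a\<close>, so the image measure has constant density \<open>pi\<close> on the
  half-line.\<close>

lemma distr_lborel_norm_square_plane:
  "distr (lborel :: (real \<times> real) measure) borel (\<lambda>w. (norm w)\<^sup>2)
    = density lborel (\<lambda>s. ennreal pi * indicator {0..} s)" (is "?M = ?N")
proof (rule measure_eqI_generator_eq[where E = "range atMost" and \<Omega> = UNIV and A = "\<lambda>n. {..real n}"])
  show "Int_stable (range (atMost :: real \<Rightarrow> real set))"
    by (auto simp: Int_stable_def)
  have eq: "emeasure ?M {..a} = ennreal (pi * max 0 a)" and eqN: "emeasure ?N {..a} = ennreal (pi * max 0 a)" for a
  proof -
    have "emeasure ?M {..a} = emeasure lborel {w :: real \<times> real. (norm w)\<^sup>2 \<le> a}"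
      by (subst emeasure_distr) (auto simp: vimage_def)
    also have "\<dots> = ennreal (pi * max 0 a)"
    proof (cases "0 \<le> a")
      case True
      have "{w :: real \<times> real. (norm w)\<^sup>2 \<le> a} = cball 0 (sqrt a)"
        using True by (auto simp: real_le_rsqrt) (metis norm_ge_zero power_mono real_sqrt_pow2)
      then show ?thesis
        using True by (simp add: emeasure_cball unit_ball_vol_2)
    next
      case False
      then have "{w :: real \<times> real. (norm w)\<^sup>2 \<le> a} = {}"
        by (auto simp: not_le intro: less_le_trans)
      then show ?thesis
        using False by (simp only: emeasure_empty) simp
    qed
    finally show "emeasure ?M {..a} = ennreal (pi * max 0 a)" .
    have "emeasure ?N {..a} = (\<integral>\<^sup>+s. ennreal pi * indicator {0..a} s \<partial>lborel)"
      by (subst emeasure_density) (auto intro!: nn_integral_cong simp: indicator_def)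
    also have "\<dots> = ennreal (pi * max 0 a)"
      by (subst nn_integral_cmult_indicator) (auto simp: ennreal_mult max_def)
    finally show "emeasure ?N {..a} = ennreal (pi * max 0 a)" .
  qed
  show "emeasure ?M X = emeasure ?N X" if "X \<in> range atMost" for X
    using that eq eqN by auto
  show "sets ?M = sigma_sets UNIV (range atMost)" "sets ?N = sigma_sets UNIV (range atMost)"
    by (simp_all add: borel_eq_atMost)
  show "(\<Union>n. {..real n}) = UNIV"
    using real_arch_simple by auto
  show "emeasure ?M {..real n} \<noteq> \<infinity>" for n
    by (simp add: eq)
  show "range (\<lambda>n. {..real n}) \<subseteq> range atMost" "range atMost \<subseteq> Pow (UNIV :: real set)"
    by auto
qed

text \<open>Here \<open>a\<close> is the component along \<open>e\<close> and \<open>s\<close> the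
  squared distance from that axis. An orthogonal map takes the first basis vector to
  \<open>e\<close>; the remaining plane integral depends only on the squared radius.\<close>

lemma nn_integral_cylindrical:
  fixes e :: "real ^ 3" and F :: "real \<Rightarrow> real \<Rightarrow> ennreal"
  assumes e: "norm e = 1" and F[measurable]: "case_prod F \<in> borel_measurable borel"
  shows "(\<integral>\<^sup>+v. F (e \<bullet> v) ((norm v)\<^sup>2 - (e \<bullet> v)\<^sup>2) \<partial>lborel)
    = (\<integral>\<^sup>+a. \<integral>\<^sup>+s. ennreal pi * indicator {0..} s * F a s \<partial>lborel \<partial>lborel)"
proof -
  obtain T :: "real ^ 3 \<Rightarrow> real ^ 3" where T: "orthogonal_transformation T" and Te: "T (axis 1 1) = e"
    by (rule orthogonal_transformation_exists_1[of "axis 1 1 :: real ^ 3" e]) (simp_all add: e norm_axis_1)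
  have Tm: "T \<in> borel_measurable borel"
    by (intro borel_measurable_continuous_onI linear_continuous_on)
       (use orthogonal_transformation_linear[OF T] in \<open>simp add: linear_conv_bounded_linear\<close>)
  let ?V = "\<lambda>(a, b, c). vector [a, b, c] :: real ^ 3"
  have V: "?V p = fst p *\<^sub>R axis 1 1 + fst (snd p) *\<^sub>R axis 2 1 + snd (snd p) *\<^sub>R axis 3 1" for p
    by (cases p) (auto simp: vec_eq_iff forall_3 axis_def)
  have Vm: "?V \<in> borel_measurable borel"
    unfolding V by (intro borel_measurable_continuous_onI continuous_intros)
  have F': "(\<lambda>x. F (f x) (g x)) \<in> borel_measurable M"
    if "f \<in> borel_measurable M" "g \<in> borel_measurable M" for f g and M :: "'z measure"
    using measurable_compose[OF borel_measurable_Pair[OF that] F] by simp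
  have "(\<integral>\<^sup>+v. F (e \<bullet> v) ((norm v)\<^sup>2 - (e \<bullet> v)\<^sup>2) \<partial>lborel)
      = (\<integral>\<^sup>+v. F (e \<bullet> v) ((norm v)\<^sup>2 - (e \<bullet> v)\<^sup>2) \<partial>distr lborel borel T)"
    by (simp add: distr_lborel_orthogonal_transformation[OF T])
  also have "\<dots> = (\<integral>\<^sup>+v. F (axis 1 1 \<bullet> (v :: real ^ 3)) ((norm v)\<^sup>2 - (axis 1 1 \<bullet> v)\<^sup>2) \<partial>lborel)"
    using T Tm by (subst nn_integral_distr)
      (auto intro!: F' simp: Te[symmetric] orthogonal_transformation_def orthogonal_transformation_norm[OF T])
  also have "\<dots> = (\<integral>\<^sup>+v. F (axis 1 1 \<bullet> v) ((norm v)\<^sup>2 - (axis 1 1 \<bullet> v)\<^sup>2) \<partial>distr lborel borel ?V)"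
    by (simp add: distr_lborel_vector_3)
  also have "\<dots> = (\<integral>\<^sup>+p. F (axis 1 1 \<bullet> ?V p) ((norm (?V p))\<^sup>2 - (axis 1 1 \<bullet> ?V p)\<^sup>2) \<partial>lborel)"
    by (rule nn_integral_distr) (use Vm in \<open>auto intro!: F'\<close>)
  also have "\<dots> = (\<integral>\<^sup>+p. F (fst p) ((norm (snd (p :: real \<times> real \<times> real)))\<^sup>2) \<partial>lborel)"
  proof -
    have "(norm (vector [a, b, c] :: real ^ 3))\<^sup>2 = a\<^sup>2 + (b\<^sup>2 + c\<^sup>2)" for a b c
      unfolding power2_norm_eq_inner inner_vec_def sum_3 by (simp add: power2_eq_square)
    then show ?thesis
      by (intro nn_integral_cong) (auto simp: inner_axis' norm_Pair)
  qed
  also have "\<dots> = (\<integral>\<^sup>+a. \<integral>\<^sup>+w. F a ((norm (w :: real \<times> real))\<^sup>2) \<partial>lborel \<partial>lborel)"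
  proof (subst nn_integral_lborel_pair)
    have "(fst :: real \<times> real \<times> real \<Rightarrow> real) \<in> borel_measurable borel"
      "(\<lambda>p :: real \<times> real \<times> real. (norm (snd p))\<^sup>2) \<in> borel_measurable borel"
      by (intro borel_measurable_continuous_onI continuous_intros)+
    then show "(\<lambda>p :: real \<times> real \<times> real. F (fst p) ((norm (snd p))\<^sup>2)) \<in> borel_measurable borel"
      by (rule F')
  qed simp
  also have "\<dots> = (\<integral>\<^sup>+a. \<integral>\<^sup>+s. F a s \<partial>distr (lborel :: (real \<times> real) measure) borel (\<lambda>w. (norm w)\<^sup>2) \<partial>lborel)"
    by (subst nn_integral_distr) (auto intro!: F')
  also have "\<dots> = (\<integral>\<^sup>+a. \<integral>\<^sup>+s. ennreal pi * indicator {0..} s * F a s \<partial>lborel \<partial>lborel)"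
    unfolding distr_lborel_norm_square_plane
    by (subst nn_integral_density) (auto intro!: F')
  finally show ?thesis .
qed

subsection \<open>The velocity profile\<close>

text \<open>The functions \<open>k\<close> and \<open>W\<close> obtained from \<open>q = 1 - 4 t\<^sup>3 + 3 t\<^sup>4\<close>.\<close>

definition slope_profile :: "real \<Rightarrow> real \<Rightarrow> real" where
  "slope_profile \<Gamma> L = 12 * (L / \<Gamma>)\<^sup>2 * (4 - 5 * (L / \<Gamma>)) / \<Gamma>"

definition base_profile :: "real \<Rightarrow> real \<Rightarrow> real" where
  "base_profile \<Gamma> L = 1 - 4 * (L / \<Gamma>) ^ 3 + 3 * (L / \<Gamma>) ^ 4
     + (1 - L) / \<Gamma> * (12 * (L / \<Gamma>)\<^sup>2 * (1 - L / \<Gamma>))"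

text \<open>For \<open>s = sqrt (L / \<Gamma>)\<close> this is the positivity of the velocity
  profile in its worst case, with a constant enlarged to leave room for \<open>\<Gamma> < 1\<close>.
  The difference of the two sides is a polynomial of degree 6 that has only positive coefficients in
  a basis adapted to each side of \<open>1 / 2\<close>.\<close>

lemma profile_polynomial_bound:
  fixes s :: real
  assumes "0 \<le> s"
  shows "25 * s ^ 4 * (4 - 5 * s\<^sup>2) < (1 + s)\<^sup>2 * (1 + 2 * s\<^sup>2 + 15 * s ^ 4)"
proof -
  have "0 < 1 + 2 * s + 3 * s ^ 2 + 4 * s ^ 3 - 83 * s ^ 4 + 30 * s ^ 5 + 140 * s ^ 6" (is "0 < ?p")
  proof (cases "s \<le> 1 / 2")
    case True
    define y where "y = 1 - 2 * s"
    have y: "0 \<le> y"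
      using True by (simp add: y_def)
    \<comment> \<open>the Bernstein form of \<open>?p\<close> on \<open>[0, 1 / 2]\<close>\<close>
    have "?p = y ^ 6 + 14 * s * y ^ 5 + 83 * s ^ 2 * y ^ 4 + 268 * s ^ 3 * y ^ 3
        + 413 * s ^ 4 * y ^ 2 + 194 * s ^ 5 * y + 76 * s ^ 6"
      unfolding y_def by (simp add: algebra_simps eval_nat_numeral)
    moreover have "0 < y ^ 6 + 76 * s ^ 6"
      using assms y by (cases "s = 0") (auto simp: y_def intro: add_nonneg_pos)
    moreover have "0 \<le> 14 * s * y ^ 5 + 83 * s ^ 2 * y ^ 4 + 268 * s ^ 3 * y ^ 3
        + 413 * s ^ 4 * y ^ 2 + 194 * s ^ 5 * y"
      using assms y by simp
    ultimately show ?thesis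
      by linarith
  next
    case False
    define d where "d = s - 1 / 2"
    have d: "0 \<le> d" "s = 1 / 2 + d"
      using False by (auto simp: d_def)
    \<comment> \<open>the Taylor expansion of \<open>?p\<close> at \<open>1 / 2\<close>\<close>
    have "?p = 19 / 16 + 17 / 8 * d + 213 / 4 * d ^ 2 + 263 * d ^ 3 + 517 * d ^ 4 + 450 * d ^ 5 + 140 * d ^ 6"
      unfolding d(2) by (simp add: field_simps eval_nat_numeral)
    then show ?thesis
      using d(1) by (simp add: add_pos_nonneg)
  qed
  then show ?thesis
    by (simp add: algebra_simps power2_eq_square power3_eq_cube power4_eq_xxxx eval_nat_numeral)
qed

text \<open>If \<open>4 \<le> 5 * (L / \<Gamma>)\<close>, the slope term has the favourable sign and
  positivity of \<open>base_profile\<close> suffices. Otherwise the worst case is the largest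
  \<open>q\<close>, and the estimate perturbs the case \<open>\<Gamma> = 1\<close>.\<close>

lemma profile_pos:
  fixes \<Gamma> L q :: real
  assumes \<Gamma>: "1 - 1 / 2 ^ 12 \<le> \<Gamma>" "\<Gamma> < 1" and L: "0 \<le> L" "L < \<Gamma>"
    and q: "0 \<le> q" "q \<le> (1 - sqrt L)\<^sup>2"
  shows "0 < base_profile \<Gamma> L - 2 * slope_profile \<Gamma> L * q"
proof -
  define t where "t = L / \<Gamma>"
  define s where "s = sqrt t"
  have \<Gamma>0: "0 < \<Gamma>"
    using \<Gamma> by simp
  have t: "0 \<le> t" "t < 1" "L = \<Gamma> * t"
    using \<Gamma>0 L by (auto simp: t_def)
  have s: "0 \<le> s" "s < 1" "t = s\<^sup>2"
    using t by (auto simp: s_def)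
  have t4: "t ^ 2 = s ^ 4" "t ^ 3 = s ^ 6"
    by (simp_all add: s(3) power_mult[symmetric])
  \<comment> \<open>For \<open>\<Gamma> = 1\<close> the claim, divided by \<open>(1 - s)\<^sup>2\<close>, is \<open>profile_polynomial_bound\<close> with 24 in place
    of 25; the difference pays for \<open>\<Gamma> < 1\<close>.\<close>
  have "12 * t\<^sup>2 * (1 - t) * (1 - t) \<le> 12 * t\<^sup>2 * (1 - t) * ((1 - L) / \<Gamma>)"
  proof (rule mult_left_mono)
    have "(1 - t) * \<Gamma> \<le> 1 - L"
      using \<Gamma> by (simp add: t(3) algebra_simps)
    then show "1 - t \<le> (1 - L) / \<Gamma>"
      using \<Gamma>0 by (simp add: pos_le_divide_eq)
  qed (use t in simp)
  then have "1 - 4 * t ^ 3 + 3 * t ^ 4 + 12 * t\<^sup>2 * (1 - t) * (1 - t) \<le> base_profile \<Gamma> L"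
    by (simp add: base_profile_def t_def[symmetric] mult_ac)
  \<comment> \<open>\<open>1 - 4 * t ^ 3 + 3 * t ^ 4\<close> has the factor
    \<open>(1 - t)\<^sup>2\<close>, with cofactor \<open>1 + 2 * t + 3 * t\<^sup>2\<close>.\<close>
  then have w: "(1 - t)\<^sup>2 * (1 + 2 * t + 15 * t\<^sup>2) \<le> base_profile \<Gamma> L"
    by (simp add: algebra_simps eval_nat_numeral)
  have w0: "0 < base_profile \<Gamma> L"
    using t by (intro less_le_trans[OF _ w] mult_pos_pos) (auto intro: add_pos_nonneg)
  show ?thesis
  proof (cases "4 \<le> 5 * t")
    case True
    then have "slope_profile \<Gamma> L \<le> 0"
      using \<Gamma>0 by (auto simp: slope_profile_def t_def[symmetric] divide_le_0_iff mult_le_0_iff)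
    then have "slope_profile \<Gamma> L * q \<le> 0"
      using q by (simp add: mult_nonpos_nonneg)
    then show ?thesis
      using w0 by simp
  next
    case False
    have "s\<^sup>2 \<le> (9 / 10)\<^sup>2"
      using False s(3) by (simp add: power2_eq_square)
    then have s9: "s \<le> 9 / 10"
      by (rule power2_le_imp_le) simp
    have "\<Gamma> * s \<le> sqrt L"
    proof (rule real_le_rsqrt)
      have "\<Gamma> * (\<Gamma> * t) \<le> 1 * (\<Gamma> * t)"
        using \<Gamma> \<Gamma>0 t by (intro mult_right_mono) auto
      then show "(\<Gamma> * s)\<^sup>2 \<le> L"
        by (simp add: t(3) s(3) power2_eq_square mult_ac)
    qed
    \<comment> \<open>The left side exceeds \<open>1 - s\<close> by at most
      \<open>s / 2 ^ 12\<close>, and \<open>s \<le> 9 / 10\<close> gives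
      \<open>s \<le> 10 * (1 - s)\<close>.\<close>
    moreover have "1 - \<Gamma> * s \<le> (1 + 10 / 2 ^ 12) * (1 - s)"
    proof -
      have "(1 - 1 / 2 ^ 12) * s \<le> \<Gamma> * s"
        using \<Gamma> s by (intro mult_right_mono) auto
      then show ?thesis
        using s9 by (simp add: field_simps)
    qed
    moreover have "sqrt L \<le> 1"
      using L \<Gamma> by simp
    ultimately have "(1 - sqrt L)\<^sup>2 \<le> ((1 + 10 / 2 ^ 12) * (1 - s))\<^sup>2"
      by (intro power_mono) auto
    also have "\<dots> = (1 + 10 / 2 ^ 12)\<^sup>2 * (1 - s)\<^sup>2"
      by (rule power_mult_distrib)
    \<comment> \<open>The factor \<open>25 / 24\<close> covers the squared perturbation and a spare
      factor \<open>\<Gamma>\<close>, which later cancels the denominator of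
      \<open>slope_profile\<close>.\<close>
    also have "\<dots> \<le> (25 / 24 * (1 - 1 / 2 ^ 12)) * (1 - s)\<^sup>2"
      by (intro mult_right_mono) (simp_all add: power2_eq_square)
    also have "\<dots> \<le> (25 / 24 * \<Gamma>) * (1 - s)\<^sup>2"
      using \<Gamma> by (intro mult_right_mono) auto
    finally have "q \<le> 25 / 24 * \<Gamma> * (1 - s)\<^sup>2"
      using q by simp
    moreover have k0: "0 \<le> 24 * t\<^sup>2 * (4 - 5 * t) / \<Gamma>"
      using False \<Gamma>0 by simp
    ultimately have "24 * t\<^sup>2 * (4 - 5 * t) / \<Gamma> * q \<le> 24 * t\<^sup>2 * (4 - 5 * t) / \<Gamma> * (25 / 24 * \<Gamma> * (1 - s)\<^sup>2)"
      by (rule mult_left_mono)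
    also have "\<dots> = (25 * s ^ 4 * (4 - 5 * s\<^sup>2)) * (1 - s)\<^sup>2"
      using \<Gamma>0 by (simp add: t4 s(3)[symmetric])
    also have "\<dots> < ((1 + s)\<^sup>2 * (1 + 2 * s\<^sup>2 + 15 * s ^ 4)) * (1 - s)\<^sup>2"
      using s by (intro mult_strict_right_mono profile_polynomial_bound) auto
    also have "\<dots> = (1 - t)\<^sup>2 * (1 + 2 * t + 15 * t\<^sup>2)"
      unfolding t4 unfolding s(3) by (simp add: algebra_simps eval_nat_numeral)
    finally show ?thesis
      using w by (simp add: slope_profile_def t_def[symmetric])
  qed
qed

lemma profile_nonneg:
  fixes \<Gamma> L q :: real
  assumes \<Gamma>: "1 - 1 / 2 ^ 12 \<le> \<Gamma>" "\<Gamma> < 1" and L: "0 \<le> L" "L \<le> \<Gamma>"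
    and q: "0 \<le> q" "q \<le> (1 - sqrt L)\<^sup>2"
  shows "0 \<le> base_profile \<Gamma> L - 2 * slope_profile \<Gamma> L * q"
proof (cases "L = \<Gamma>")
  case True
  have "0 < \<Gamma>"
    using \<Gamma> by simp
  \<comment> \<open>At \<open>L = \<Gamma>\<close> the base profile is \<open>1 - 4 + 3 = 0\<close>
    and the slope profile is \<open>- 12 / \<Gamma>\<close>.\<close>
  then show ?thesis
    using True q by (simp add: base_profile_def slope_profile_def)
next
  case False
  then show ?thesis
    using profile_pos[OF \<Gamma> L(1) _ q] L by simp
qed

text \<open>The integral over the radial velocity \<open>a\<close>:
  \<open>1 / sqrt (A - a\<^sup>2)\<close> integrates to \<open>pi\<close>, and
  \<open>sqrt (A - a\<^sup>2)\<close> to half the disc area \<open>pi * A\<close>, which turns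
  \<open>2 * k\<close> into \<open>k\<close>.\<close>

lemma nn_integral_inverse_sqrt_profile:
  fixes A w k :: real
  assumes pos: "\<And>q. 0 < q \<Longrightarrow> q \<le> A \<Longrightarrow> 0 \<le> w - 2 * k * q"
  shows "(\<integral>\<^sup>+a. ennreal (if a\<^sup>2 < A then (w - 2 * k * (A - a\<^sup>2)) / sqrt (A - a\<^sup>2) else 0) \<partial>lborel)
    = ennreal (if 0 < A then pi * (w - k * A) else 0)"
proof (cases "0 < A")
  case True
  define h where "h a = (if a\<^sup>2 < A then (w - 2 * k * (A - a\<^sup>2)) / sqrt (A - a\<^sup>2) else 0)" for a
  define R where "R = sqrt A"
  have R: "0 < R" "R\<^sup>2 = A"
    using True by (auto simp: R_def)
  have inside: "a\<^sup>2 < A \<longleftrightarrow> - R < a \<and> a < R" for a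
    using R abs_square_less_1[of "a / R"] by (auto simp: power_divide)
  \<comment> \<open>This primitive is continuous up to \<open>- R\<close> and \<open>R\<close>,
    where the integrand may blow up, so its derivative is needed only inside.\<close>
  let ?H = "\<lambda>a. w * arcsin (a / R) - k * (a * sqrt (A - a\<^sup>2) + A * arcsin (a / R))"
  have "(h has_integral (?H R - ?H (- R))) {- R..R}"
  proof (rule fundamental_theorem_of_calculus_interior)
    show "continuous_on {- R..R} ?H"
      using R by (intro continuous_intros) (auto simp: field_simps)
    fix a
    assume a: "a \<in> {- R<..<R}"
    then have d: "0 < A - a\<^sup>2"
      using inside[of a] by simp
    have eq: "1 - (a / R)\<^sup>2 = (A - a\<^sup>2) / A"
      using R True by (simp add: power_divide diff_divide_distrib)
    have ar: "((\<lambda>a. arcsin (a / R)) has_real_derivative 1 / sqrt (A - a\<^sup>2)) (at a)"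
      using a R d by (auto intro!: derivative_eq_intros simp: eq real_sqrt_divide R_def[symmetric] field_simps)
    have sq: "((\<lambda>a. a * sqrt (A - a\<^sup>2)) has_real_derivative (sqrt (A - a\<^sup>2) - a\<^sup>2 / sqrt (A - a\<^sup>2))) (at a)"
      using d by (auto intro!: derivative_eq_intros simp: field_simps power2_eq_square)
    have "(?H has_real_derivative (w * (1 / sqrt (A - a\<^sup>2)) - k * ((sqrt (A - a\<^sup>2) - a\<^sup>2 / sqrt (A - a\<^sup>2)) + A * (1 / sqrt (A - a\<^sup>2))))) (at a)"
      by (intro DERIV_diff DERIV_cmult DERIV_add ar sq)
    also have "w * (1 / sqrt (A - a\<^sup>2)) - k * ((sqrt (A - a\<^sup>2) - a\<^sup>2 / sqrt (A - a\<^sup>2)) + A * (1 / sqrt (A - a\<^sup>2))) = h a"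
    proof -
      have "sqrt (A - a\<^sup>2) * sqrt (A - a\<^sup>2) = A - a\<^sup>2"
        using d by simp
      then have "sqrt (A - a\<^sup>2) = (A - a\<^sup>2) / sqrt (A - a\<^sup>2)"
        using d by (simp add: field_simps)
      then have "(sqrt (A - a\<^sup>2) - a\<^sup>2 / sqrt (A - a\<^sup>2)) + A * (1 / sqrt (A - a\<^sup>2)) = 2 * (A - a\<^sup>2) / sqrt (A - a\<^sup>2)"
        using d by (simp add: field_simps)
      moreover have "h a = w * (1 / sqrt (A - a\<^sup>2)) - k * (2 * (A - a\<^sup>2) / sqrt (A - a\<^sup>2))"
      proof -
        have "(w - 2 * k * B) / S = w * (1 / S) - k * (2 * B / S)" for B S :: real
          by (simp add: diff_divide_distrib)
        then show ?thesis
          using d by (simp add: h_def)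
      qed
      ultimately show ?thesis
        by simp
    qed
    finally show "(?H has_vector_derivative h a) (at a)"
      by (rule has_real_derivative_iff_has_vector_derivative[THEN iffD1])
  qed (use R in simp)
  also have "?H R - ?H (- R) = pi * (w - k * A)"
    using R by (simp add: arcsin_minus algebra_simps)
  finally have "((\<lambda>a. if a \<in> {- R..R} then h a else 0) has_integral pi * (w - k * A)) UNIV"
    by (simp only: has_integral_restrict_UNIV)
  also have "(\<lambda>a. if a \<in> {- R..R} then h a else 0) = h"
    using inside by (auto simp: h_def fun_eq_iff)
  finally have "(h has_integral pi * (w - k * A)) UNIV" .
  moreover have "0 \<le> h a" for a
    using pos[of "A - a\<^sup>2"] by (auto simp: h_def)
  moreover have "h \<in> borel_measurable borel"
    unfolding h_def by measurable
  ultimately show ?thesis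
    using nn_integral_has_integral_lborel[of h] True by (simp add: h_def)
next
  case False
  then have "\<not> a\<^sup>2 < A" for a
    using zero_le_power2[of a] by linarith
  then show ?thesis
    using False by simp
qed

text \<open>The density equation in the variable \<open>s = L / u\<close>. With \<open>q\<close> as
  in the overview, primitives in \<open>L\<close> of \<open>W\<close>, \<open>k\<close> and
  \<open>L * k\<close> are \<open>- (1 - L) * q\<close>, \<open>- (q + L * q')\<close> and
  \<open>- L\<^sup>2 * q'\<close>. At the upper limit \<open>L = u\<close> all terms with
  \<open>q\<close> and \<open>q'\<close> cancel; at \<open>L = \<Gamma>\<close> they vanish. Both
  cases leave the value \<open>u\<close>.\<close>

lemma nn_integral_profile:
  fixes \<Gamma> u :: real
  assumes \<Gamma>: "0 < \<Gamma>" "\<Gamma> < 1" and u: "0 < u" "u < 1"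
    and pos: "\<And>L. 0 \<le> L \<Longrightarrow> L \<le> u \<Longrightarrow> L \<le> \<Gamma> \<Longrightarrow> 0 \<le> base_profile \<Gamma> L - slope_profile \<Gamma> L * ((1 - u) * (1 - L / u))"
  shows "(\<integral>\<^sup>+s. ennreal (if 0 \<le> s \<and> s < 1 \<and> u * s \<le> \<Gamma>
      then base_profile \<Gamma> (u * s) - slope_profile \<Gamma> (u * s) * ((1 - u) * (1 - s)) else 0) \<partial>lborel) = 1"
    (is "?I = 1")
proof -
  \<comment> \<open>The upper limit of \<open>s\<close>: the bound 1 from \<open>L \<le> u\<close>
    if \<open>u \<le> \<Gamma>\<close>, otherwise the cutoff
    \<open>L \<le> \<Gamma>\<close>.\<close>
  define m where "m = min 1 (\<Gamma> / u)"
  have m0: "0 < m"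
    using \<Gamma>(1) u(1) by (simp add: m_def)
  have m: "s \<le> m \<longleftrightarrow> s \<le> 1 \<and> u * s \<le> \<Gamma>" for s
    using pos_le_divide_eq[OF u(1), of s \<Gamma>] by (simp add: m_def mult.commute)
  \<comment> \<open>\<open>G t\<close> is the integral over \<open>[0, \<Gamma> t]\<close> in the variable \<open>L\<close>; it takes the value \<open>u\<close> at both possible upper limits.\<close>
  define c where "c = (1 - u) / u * \<Gamma>"
  define G where "G t = 1 - (1 - \<Gamma> * t) * (1 - 4 * t ^ 3 + 3 * t ^ 4)
    - (1 - u) * (16 * t ^ 3 - 15 * t ^ 4) + c * (12 * t ^ 4 - 12 * t ^ 5)" for t
  define G' where "G' t = \<Gamma> * (1 - 4 * t ^ 3 + 3 * t ^ 4) + (1 - \<Gamma> * t) * (12 * t ^ 2 * (1 - t))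
    - (1 - u) * (12 * t ^ 2 * (4 - 5 * t)) + c * (12 * t ^ 2 * (4 - 5 * t)) * t" for t
  define \<Psi> where "\<Psi> s = G (u / \<Gamma> * s) / u" for s
  define h where "h s = base_profile \<Gamma> (u * s) - slope_profile \<Gamma> (u * s) * ((1 - u) * (1 - s))" for s
  \<comment> \<open>The strict inequality \<open>s < 1\<close> and the closed interval differ at
    most in the point 1, a null set.\<close>
  have "?I = (\<integral>\<^sup>+s. ennreal (h s) * indicator {0..m} s \<partial>lborel)"
  proof (rule nn_integral_cong_AE)
    show "AE s in lborel. ennreal (if 0 \<le> s \<and> s < 1 \<and> u * s \<le> \<Gamma>
        then base_profile \<Gamma> (u * s) - slope_profile \<Gamma> (u * s) * ((1 - u) * (1 - s)) else 0)
      = ennreal (h s) * indicator {0..m} s"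
      using AE_lborel_singleton[of 1]
    proof eventually_elim
      case (elim s)
      then have "s \<in> {0..m} \<longleftrightarrow> 0 \<le> s \<and> s < 1 \<and> u * s \<le> \<Gamma>"
        using m[of s] by auto
      then show ?case
        by (simp only: h_def indicator_def) simp
    qed
  qed
  also have "\<dots> = ennreal (\<Psi> m - \<Psi> 0)"
  proof (rule nn_integral_FTC_Icc)
    show "h \<in> borel_measurable borel"
      unfolding h_def base_profile_def slope_profile_def by measurable
    fix s
    assume s: "s \<in> {0..m}"
    have "DERIV G t :> G' t" for t
      unfolding G_def G'_def
      by (auto intro!: derivative_eq_intros simp: algebra_simps eval_nat_numeral)
    moreover have "DERIV (\<lambda>s. u / \<Gamma> * s) s :> u / \<Gamma>"
      using \<Gamma> by (auto intro!: derivative_eq_intros)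
    ultimately have "DERIV (\<lambda>s. G (u / \<Gamma> * s)) s :> G' (u / \<Gamma> * s) * (u / \<Gamma>)"
      by (rule DERIV_chain2)
    then have "DERIV \<Psi> s :> G' (u / \<Gamma> * s) * (u / \<Gamma>) / u"
      unfolding \<Psi>_def by (rule DERIV_cdivide)
    also have "G' (u / \<Gamma> * s) * (u / \<Gamma>) / u = h s"
    proof -
      define t where "t = u * s / \<Gamma>"
      have "G' t / \<Gamma> = 1 - 4 * t ^ 3 + 3 * t ^ 4 + (1 - \<Gamma> * t) / \<Gamma> * (12 * t ^ 2 * (1 - t))
          - 12 * t ^ 2 * (4 - 5 * t) / \<Gamma> * ((1 - u) * (1 - \<Gamma> * t / u))"
        unfolding G'_def c_def using \<Gamma> u
        by (simp add: add_divide_distrib diff_divide_distrib) (simp add: field_simps)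
      moreover have "\<Gamma> * t = u * s"
        using \<Gamma> by (simp add: t_def)
      ultimately show ?thesis
        using \<Gamma> u by (simp add: h_def base_profile_def slope_profile_def t_def[symmetric])
    qed
    finally show "DERIV \<Psi> s :> h s" .
    have "u * s \<le> \<Gamma>" "u * s \<le> u"
      using s m[of s] u by auto
    then show "0 \<le> h s"
      using pos[of "u * s"] s u by (simp add: h_def)
  qed (use m0 in simp)
  also have "\<Psi> m - \<Psi> 0 = 1"
  proof -
    have "G (u / \<Gamma> * m) = u"
    proof (cases "u \<le> \<Gamma>")
      case True
      then have "m = 1"
        using u by (simp add: m_def)
      define t where "t = u / \<Gamma>"
      have "u = \<Gamma> * t" "t \<noteq> 0"
        using \<Gamma> u by (auto simp: t_def)
      then have "G t = u"
        using \<Gamma> by (simp add: G_def c_def field_simps eval_nat_numeral)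
      then show ?thesis
        using \<open>m = 1\<close> by (simp add: t_def)
    next
      case False
      then have "m = \<Gamma> / u"
        using u by (simp add: m_def min_def)
      have "u / \<Gamma> * m = 1"
        unfolding \<open>m = \<Gamma> / u\<close> using \<Gamma> u by simp
      show ?thesis
        unfolding \<open>u / \<Gamma> * m = 1\<close> by (simp add: G_def)
    qed
    then show ?thesis
      using u by (simp add: \<Psi>_def) (simp add: G_def)
  qed
  finally show ?thesis
    by simp
qed

subsection \<open>The density of the solution\<close>

text \<open>The constant is the density \<open>3 / (4 * pi)\<close> divided by
  \<open>pi\<^sup>2\<close>: one \<open>pi\<close> comes from the cylindrical volume element, the
  other from the integral over the radial velocity.\<close>

definition profile :: "real \<Rightarrow> real \<Rightarrow> real \<Rightarrow> real" where
  "profile \<Gamma> Q L = (if 0 < Q \<and> L \<le> \<Gamma>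
     then 3 / (4 * pi ^ 3) * ((base_profile \<Gamma> L - 2 * slope_profile \<Gamma> L * Q) / sqrt Q) else 0)"

definition ang_sq :: "phase \<Rightarrow> real" where
  "ang_sq z = (norm (cross3 (fst z) (snd z)))\<^sup>2"

text \<open>The invariant \<open>Q\<close>. By Lagrange's identity for \<open>ang_sq\<close> it
  equals \<open>(1 - |x|^2) (1 - |v|^2) - (x \<bullet> v)^2\<close>; its nonnegativity is the first
  inequality in \<open>D\<close>.\<close>

definition defect :: "phase \<Rightarrow> real" where
  "defect z = 1 - (norm (fst z))\<^sup>2 - (norm (snd z))\<^sup>2 + ang_sq z"

definition ball_solution :: "real \<Rightarrow> phase \<Rightarrow> real" where
  "ball_solution \<Gamma> z = profile \<Gamma> (defect z) (ang_sq z)"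

lemma ang_sq_nonneg [simp]: "0 \<le> ang_sq z"
  by (simp add: ang_sq_def)

lemma continuous_ang_sq: "continuous_on UNIV ang_sq"
  unfolding ang_sq_def norm_cross by (intro continuous_intros)

lemma continuous_defect: "continuous_on UNIV defect"
  unfolding defect_def by (intro continuous_intros continuous_ang_sq)

lemma profile_measurable [measurable]:
  assumes [measurable]: "f \<in> borel_measurable M" "g \<in> borel_measurable M"
  shows "(\<lambda>z. profile \<Gamma> (f z) (g z)) \<in> borel_measurable M"
  unfolding profile_def base_profile_def slope_profile_def by measurable

lemma ball_solution_measurable [measurable]: "ball_solution \<Gamma> \<in> borel_measurable borel"
proof -
  have [measurable]: "ang_sq \<in> borel_measurable borel" "defect \<in> borel_measurable borel"
    by (intro borel_measurable_continuous_onI continuous_ang_sq continuous_defect)+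
  show ?thesis
    unfolding ball_solution_def by measurable
qed

text \<open>Supplies the bound on \<open>q\<close> in \<open>profile_pos\<close>. It combines
  \<open>norm (cross3 x v) \<le> norm x * norm v\<close> with the inequality of arithmetic and
  geometric means.\<close>

lemma defect_le: "defect z \<le> (1 - sqrt (ang_sq z))\<^sup>2"
proof -
  obtain x v where z: "z = (x, v)"
    by fastforce
  have "(norm (cross3 x v))\<^sup>2 \<le> (norm x * norm v)\<^sup>2"
    using norm_cross_dot[of x v] zero_le_power2[of "x \<bullet> v"] by linarith
  then have "norm (cross3 x v) \<le> norm x * norm v"
    by (rule power2_le_imp_le) simp
  moreover have "2 * (norm x * norm v) \<le> (norm x)\<^sup>2 + (norm v)\<^sup>2"
    using sum_squares_bound[of "norm x" "norm v"] by simp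
  ultimately show ?thesis
    by (simp add: z defect_def ang_sq_def power2_diff)
qed

lemma ball_solution_pos:
  assumes "1 - 1 / 2 ^ 12 \<le> \<Gamma>" "\<Gamma> < 1" "0 < defect z" "ang_sq z < \<Gamma>"
  shows "0 < ball_solution \<Gamma> z"
proof -
  have "0 < base_profile \<Gamma> (ang_sq z) - 2 * slope_profile \<Gamma> (ang_sq z) * defect z"
    using assms by (intro profile_pos defect_le) auto
  then have "0 < 3 / (4 * pi ^ 3) * ((base_profile \<Gamma> (ang_sq z) - 2 * slope_profile \<Gamma> (ang_sq z) * defect z) / sqrt (defect z))"
    using assms by (intro mult_pos_pos divide_pos_pos) auto
  then show ?thesis
    using assms by (simp only: ball_solution_def profile_def) simp
qed

lemma ball_solution_nonneg:
  assumes "1 - 1 / 2 ^ 12 \<le> \<Gamma>" "\<Gamma> < 1"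
  shows "0 \<le> ball_solution \<Gamma> z"
proof (cases "0 < defect z \<and> ang_sq z \<le> \<Gamma>")
  case True
  then have "0 \<le> base_profile \<Gamma> (ang_sq z) - 2 * slope_profile \<Gamma> (ang_sq z) * defect z"
    using assms by (intro profile_nonneg defect_le) auto
  then have "0 \<le> 3 / (4 * pi ^ 3) * ((base_profile \<Gamma> (ang_sq z) - 2 * slope_profile \<Gamma> (ang_sq z) * defect z) / sqrt (defect z))"
    using True by (intro mult_nonneg_nonneg divide_nonneg_nonneg) auto
  then show ?thesis
    using True by (simp only: ball_solution_def profile_def) simp
next
  case False
  then show ?thesis
    by (auto simp: ball_solution_def profile_def)
qed

text \<open>The condition on \<open>ang_sq\<close> excludes the outer part of
  \<open>0 \<le> defect\<close>: if a squared norm \<open>A\<close> exceeds 1, nonnegativity of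
  \<open>(1 - A) * (1 - B) - d\<close> forces \<open>1 \<le> B\<close>, and then
  \<open>ang_sq\<close> is \<open>A * B - d \<ge> A + B - 1 > 1\<close>. If
  \<open>norm x = 1\<close>, the defect is \<open>- (x \<bullet> v)\<^sup>2\<close>, which gives the
  strict version.\<close>

lemma norm_le_1_of_defect:
  assumes "0 \<le> defect (x, v)" "ang_sq (x, v) < 1"
  shows "norm x \<le> 1 \<and> norm v \<le> 1" and "0 < defect (x, v) \<Longrightarrow> norm x < 1"
proof -
  define X V d where "X = (norm x)\<^sup>2" and "V = (norm v)\<^sup>2" and "d = (x \<bullet> v)\<^sup>2"
  have nn: "0 \<le> X" "0 \<le> V" "0 \<le> d"
    by (simp_all add: X_def V_def d_def)
  have a: "ang_sq (x, v) = X * V - d"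
    by (simp add: ang_sq_def norm_cross X_def V_def d_def)
  then have q: "defect (x, v) = (1 - X) * (1 - V) - d"
    by (simp add: defect_def X_def V_def algebra_simps)
  have no: False if "1 < A" "(1 - A) * (1 - B) - d \<ge> 0" "A * B - d < 1" for A B
  proof -
    have "\<not> 0 < 1 - B"
      using that mult_neg_pos[of "1 - A" "1 - B"] nn by auto
    then show False
      using that by (simp add: algebra_simps)
  qed
  have X: "X \<le> 1" and V: "V \<le> 1"
    using no[of X V] no[of V X] assms unfolding a q by (auto simp: mult.commute not_less[symmetric])
  then show "norm x \<le> 1 \<and> norm v \<le> 1"
    by (simp add: X_def V_def power_le_one_iff)
  show "norm x < 1" if "0 < defect (x, v)"
  proof -
    have "X \<noteq> 1"
      using that nn unfolding q by auto
    then have "X < 1"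
      using X by simp
    then show ?thesis
      by (simp add: X_def abs_square_less_1)
  qed
qed

text \<open>The counterpart of \<open>defect_le\<close> at zero radial velocity.\<close>

lemma complement_mult_le:
  fixes u s :: real
  assumes "0 \<le> u" "0 \<le> s"
  shows "(1 - u) * (1 - s) \<le> (1 - sqrt (u * s))\<^sup>2"
  using arith_geo_mean_sqrt[OF assms] assms by (simp add: power2_diff algebra_simps)

text \<open>In cylindrical velocity coordinates about the direction of \<open>x\<close>,
  \<open>defect\<close> and \<open>ang_sq\<close> become
  \<open>(1 - u) * (1 - s) - a\<^sup>2\<close> and \<open>u * s\<close>. Integrating first over
  \<open>a\<close> and then over \<open>s\<close> brings in the two profile integrals.\<close>

lemma nn_integral_ball_solution:
  assumes \<Gamma>: "1 - 1 / 2 ^ 12 \<le> \<Gamma>" "\<Gamma> < 1" and x: "x \<noteq> 0" "norm x < 1"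
  shows "(\<integral>\<^sup>+v. ennreal (ball_solution \<Gamma> (x, v)) \<partial>lborel) = ennreal (3 / (4 * pi))"
proof -
  define u where "u = (norm x)\<^sup>2"
  define e where "e = x /\<^sub>R norm x"
  have \<Gamma>0: "0 < \<Gamma>"
    using \<Gamma> by simp
  have u: "0 < u" "u < 1"
    using x by (auto simp: u_def abs_square_less_1)
  have e: "norm e = 1" "x = norm x *\<^sub>R e"
    using x by (auto simp: e_def)
  let ?F = "\<lambda>a s. ennreal (profile \<Gamma> ((1 - u) * (1 - s) - a\<^sup>2) (u * s))"
  let ?c = "3 / (4 * pi ^ 3) :: real"
  have "ball_solution \<Gamma> (x, v) = profile \<Gamma> ((1 - u) * (1 - ((norm v)\<^sup>2 - (e \<bullet> v)\<^sup>2)) - (e \<bullet> v)\<^sup>2) (u * ((norm v)\<^sup>2 - (e \<bullet> v)\<^sup>2))" for v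
  proof -
    have "x \<bullet> v = norm x * (e \<bullet> v)"
      by (subst e(2)) simp
    then have "ang_sq (x, v) = u * ((norm v)\<^sup>2 - (e \<bullet> v)\<^sup>2)"
      by (simp add: ang_sq_def norm_cross u_def power_mult_distrib right_diff_distrib)
    moreover from this have "defect (x, v) = (1 - u) * (1 - ((norm v)\<^sup>2 - (e \<bullet> v)\<^sup>2)) - (e \<bullet> v)\<^sup>2"
      by (simp add: defect_def u_def[symmetric] algebra_simps)
    ultimately show ?thesis
      by (simp only: ball_solution_def)
  qed
  then have "(\<integral>\<^sup>+v. ennreal (ball_solution \<Gamma> (x, v)) \<partial>lborel)
      = (\<integral>\<^sup>+v. ?F (e \<bullet> v) ((norm v)\<^sup>2 - (e \<bullet> v)\<^sup>2) \<partial>lborel)"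
    by simp
  also have "\<dots> = (\<integral>\<^sup>+a. \<integral>\<^sup>+s. ennreal pi * indicator {0..} s * ?F a s \<partial>lborel \<partial>lborel)"
    by (rule nn_integral_cylindrical[OF e(1)]) (simp add: split_beta' flip: borel_prod)
  also have "\<dots> = (\<integral>\<^sup>+s. \<integral>\<^sup>+a. ennreal pi * indicator {0..} s * ?F a s \<partial>lborel \<partial>lborel)"
    by (rule lborel_pair.Fubini'[symmetric]) (simp add: split_beta')
  also have "\<dots> = (\<integral>\<^sup>+s. ennreal (pi\<^sup>2 * ?c) * ennreal (if 0 \<le> s \<and> s < 1 \<and> u * s \<le> \<Gamma>
      then base_profile \<Gamma> (u * s) - slope_profile \<Gamma> (u * s) * ((1 - u) * (1 - s)) else 0) \<partial>lborel)"
  proof (rule nn_integral_cong)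
    fix s :: real
    define w k A where "w = base_profile \<Gamma> (u * s)" and "k = slope_profile \<Gamma> (u * s)" and "A = (1 - u) * (1 - s)"
    show "(\<integral>\<^sup>+a. ennreal pi * indicator {0..} s * ?F a s \<partial>lborel)
      = ennreal (pi\<^sup>2 * ?c) * ennreal (if 0 \<le> s \<and> s < 1 \<and> u * s \<le> \<Gamma>
      then base_profile \<Gamma> (u * s) - slope_profile \<Gamma> (u * s) * ((1 - u) * (1 - s)) else 0)"
    proof (cases "0 \<le> s \<and> u * s \<le> \<Gamma>")
      case True
      have pos: "0 \<le> w - 2 * k * q" if "0 < q" "q \<le> A" for q
        unfolding w_def k_def
        using True u \<Gamma> that complement_mult_le[of u s] by (intro profile_nonneg) (auto simp: A_def)
      have A: "0 < A \<longleftrightarrow> s < 1"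
        using u by (simp add: A_def zero_less_mult_iff)
      have "(\<integral>\<^sup>+a. ennreal pi * indicator {0..} s * ?F a s \<partial>lborel)
        = (\<integral>\<^sup>+a. ennreal (pi * ?c) * ennreal (if a\<^sup>2 < A then (w - 2 * k * (A - a\<^sup>2)) / sqrt (A - a\<^sup>2) else 0) \<partial>lborel)"
        using True
        by (intro nn_integral_cong)
          (simp add: profile_def w_def[symmetric] k_def[symmetric] A_def[symmetric]
            ennreal_mult'[symmetric] mult.assoc del: times_divide_eq_left times_divide_eq_right)
      also have "\<dots> = ennreal (pi * ?c) * ennreal (if 0 < A then pi * (w - k * A) else 0)"
        by (subst nn_integral_cmult) (simp_all add: nn_integral_inverse_sqrt_profile[OF pos])
      also have "(if 0 < A then pi * (w - k * A) else 0) = pi * (if s < 1 then w - k * A else 0)"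
        using A by simp
      also have "ennreal (pi * ?c) * ennreal (pi * r) = ennreal (pi\<^sup>2 * ?c) * ennreal r" for r
      proof -
        have "ennreal (pi * ?c) * ennreal (pi * r) = ennreal ((pi * ?c) * (pi * r))"
          by (rule ennreal_mult'[symmetric]) simp
        also have "(pi * ?c) * (pi * r) = (pi\<^sup>2 * ?c) * r"
          by (simp add: power2_eq_square)
        also have "ennreal \<dots> = ennreal (pi\<^sup>2 * ?c) * ennreal r"
          by (rule ennreal_mult') simp
        finally show ?thesis .
      qed
      finally show ?thesis
        using True by (simp add: w_def k_def A_def)
    next
      case False
      then show ?thesis
        by (auto simp: profile_def)
    qed
  qed
  also have "\<dots> = ennreal (pi\<^sup>2 * ?c) * (\<integral>\<^sup>+s. ennreal (if 0 \<le> s \<and> s < 1 \<and> u * s \<le> \<Gamma>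
      then base_profile \<Gamma> (u * s) - slope_profile \<Gamma> (u * s) * ((1 - u) * (1 - s)) else 0) \<partial>lborel)"
    unfolding base_profile_def slope_profile_def by (rule nn_integral_cmult) measurable
  also have "\<dots> = ennreal (pi\<^sup>2 * ?c)"
  proof (subst nn_integral_profile)
    fix L
    assume L: "0 \<le> L" "L \<le> u" "L \<le> \<Gamma>"
    define p where "p = (1 - u) * (1 - L / u)"
    have "0 \<le> p"
      using u L by (simp add: p_def)
    moreover have "p \<le> (1 - sqrt L)\<^sup>2"
      using complement_mult_le[of u "L / u"] u L by (simp add: p_def)
    \<comment> \<open>\<open>profile_nonneg\<close> carries a factor 2 at the slope, so it is
      applied to half of \<open>p\<close>.\<close>
    ultimately have "0 \<le> base_profile \<Gamma> L - 2 * slope_profile \<Gamma> L * (p / 2)"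
      using profile_nonneg[OF \<Gamma> L(1) L(3), of "p / 2"] by linarith
    then show "0 \<le> base_profile \<Gamma> L - slope_profile \<Gamma> L * ((1 - u) * (1 - L / u))"
      by (simp add: p_def)
  qed (use \<Gamma> \<Gamma>0 u in simp_all)
  also have "pi\<^sup>2 * ?c = 3 / (4 * pi)"
    by (simp add: power2_eq_square power3_eq_cube)
  finally show ?thesis .
qed

subsection \<open>The potential of the unit ball\<close>

text \<open>Serves integrands with endpoint singularities or kinks: the primitive is differentiated
  only inside the interval and off a finite set.\<close>

lemma nn_integral_FTC_interior:
  fixes f F :: "real \<Rightarrow> real"
  assumes meas [measurable]: "f \<in> borel_measurable borel" and ab: "a \<le> b" and S: "finite S"
    and cont: "continuous_on {a..b} F"
    and deriv: "\<And>x. x \<in> {a<..<b} - S \<Longrightarrow> DERIV F x :> f x"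
    and nonneg: "\<And>x. x \<in> {a..b} \<Longrightarrow> 0 \<le> f x"
  shows "(\<integral>\<^sup>+x. ennreal (if x \<in> {a..b} then f x else 0) \<partial>lborel) = ennreal (F b - F a)"
proof (rule nn_integral_has_integral_lborel)
  have "(f has_integral (F b - F a)) {a..b}"
    using S ab cont deriv
    by (intro fundamental_theorem_of_calculus_interior_strong)
      (auto simp: has_real_derivative_iff_has_vector_derivative)
  then show "((\<lambda>x. if x \<in> {a..b} then f x else 0) has_integral (F b - F a)) UNIV"
    by (simp only: has_integral_restrict_UNIV)
qed (use nonneg in auto)

text \<open>The Newtonian integral, with \<open>a\<close> the coordinate along \<open>x\<close> and
  \<open>s\<close> the squared distance from that axis. Integration over \<open>s\<close> leaves
  \<open>2 * pi\<close> times the difference between the distances from \<open>x\<close> to the unit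
  sphere and to the axis at height \<open>a\<close>, which has an elementary primitive.\<close>

lemma nn_integral_inverse_distance_unit_ball:
  fixes x :: "real ^ 3"
  assumes x: "x \<noteq> 0" "norm x < 1"
  shows "(\<integral>\<^sup>+y. ennreal (indicator (cball 0 1) y / norm (x - y)) \<partial>lborel)
    = ennreal (2 * pi * (1 - (norm x)\<^sup>2 / 3))"
proof -
  define r where "r = norm x"
  define e where "e = x /\<^sub>R norm x"
  have r: "0 < r" "r < 1"
    using x by (auto simp: r_def)
  have e: "norm e = 1" "x = r *\<^sub>R e"
    using x by (auto simp: e_def r_def)
  let ?F = "\<lambda>a s :: real. ennreal (if a\<^sup>2 + s \<le> 1 then 1 / sqrt ((r - a)\<^sup>2 + s) else 0)"
  have "ennreal (indicator (cball 0 1) y / norm (x - y)) = ?F (e \<bullet> y) ((norm y)\<^sup>2 - (e \<bullet> y)\<^sup>2)" for y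
  proof -
    have "(norm (x - y))\<^sup>2 = (r - e \<bullet> y)\<^sup>2 + ((norm y)\<^sup>2 - (e \<bullet> y)\<^sup>2)"
      using e(1) unfolding e(2)
      by (simp add: power2_norm_eq_inner inner_diff_left inner_diff_right inner_commute power2_diff
          norm_eq_1 power2_eq_square[of r])
    then have "norm (x - y) = sqrt ((r - e \<bullet> y)\<^sup>2 + ((norm y)\<^sup>2 - (e \<bullet> y)\<^sup>2))"
      by (metis norm_ge_zero real_sqrt_unique)
    then show ?thesis
      by (simp add: indicator_def abs_square_le_1)
  qed
  then have "(\<integral>\<^sup>+y. ennreal (indicator (cball 0 1) y / norm (x - y)) \<partial>lborel)
      = (\<integral>\<^sup>+y. ?F (e \<bullet> y) ((norm y)\<^sup>2 - (e \<bullet> y)\<^sup>2) \<partial>lborel)"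
    by simp
  also have "\<dots> = (\<integral>\<^sup>+a. \<integral>\<^sup>+s. ennreal pi * indicator {0..} s * ?F a s \<partial>lborel \<partial>lborel)"
    by (rule nn_integral_cylindrical[OF e(1)]) (simp add: split_beta' flip: borel_prod)
  also have "\<dots> = (\<integral>\<^sup>+a. ennreal (if a \<in> {-1..1} then 2 * pi * (sqrt (1 + r\<^sup>2 - 2 * r * a) - \<bar>a - r\<bar>) else 0) \<partial>lborel)"
  proof (rule nn_integral_cong)
    fix a :: real
    show "(\<integral>\<^sup>+s. ennreal pi * indicator {0..} s * ?F a s \<partial>lborel)
      = ennreal (if a \<in> {-1..1} then 2 * pi * (sqrt (1 + r\<^sup>2 - 2 * r * a) - \<bar>a - r\<bar>) else 0)"
    proof (cases "a \<in> {-1..1}")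
      case True
      then have a: "a\<^sup>2 \<le> 1"
        by (simp add: abs_square_le_1 abs_le_iff)
      have "(\<integral>\<^sup>+s. ennreal pi * indicator {0..} s * ?F a s \<partial>lborel)
        = (\<integral>\<^sup>+s. ennreal (if s \<in> {0..1 - a\<^sup>2} then pi * (1 / sqrt ((r - a)\<^sup>2 + s)) else 0) \<partial>lborel)"
        by (intro nn_integral_cong) (auto simp: indicator_def ennreal_mult'[symmetric])
      also have "\<dots> = ennreal (2 * pi * sqrt ((r - a)\<^sup>2 + (1 - a\<^sup>2)) - 2 * pi * sqrt ((r - a)\<^sup>2 + 0))"
      \<comment> \<open>For \<open>a = r\<close> the integrand is singular at \<open>s = 0\<close>,
        where no derivative is required.\<close>
      proof (rule nn_integral_FTC_interior[where S = "{}"])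
        show "continuous_on {0..1 - a\<^sup>2} (\<lambda>s. 2 * pi * sqrt ((r - a)\<^sup>2 + s))"
          by (intro continuous_intros)
        fix s
        assume "s \<in> {0<..<1 - a\<^sup>2} - {}"
        then have "0 < (r - a)\<^sup>2 + s"
          by (simp add: add_nonneg_pos)
        then show "DERIV (\<lambda>s. 2 * pi * sqrt ((r - a)\<^sup>2 + s)) s :> pi * (1 / sqrt ((r - a)\<^sup>2 + s))"
          by (auto intro!: derivative_eq_intros simp: field_simps)
      qed (use a in auto)
      also have "2 * pi * sqrt ((r - a)\<^sup>2 + (1 - a\<^sup>2)) - 2 * pi * sqrt ((r - a)\<^sup>2 + 0)
          = 2 * pi * (sqrt (1 + r\<^sup>2 - 2 * r * a) - \<bar>a - r\<bar>)"
      proof -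
        have "(r - a)\<^sup>2 + (1 - a\<^sup>2) = 1 + r\<^sup>2 - 2 * r * a"
          by (simp add: power2_diff)
        then show ?thesis
          by (simp add: right_diff_distrib abs_minus_commute)
      qed
      finally show ?thesis
        using True by simp
    next
      case False
      then have "1 < a\<^sup>2"
        by (auto simp: abs_square_less_1 abs_square_le_1 not_le[symmetric] abs_le_iff)
      then have "indicator {0..} s * ?F a s = 0" for s
        by (auto simp: indicator_def)
      then show ?thesis
        using False by (simp only: mult.assoc) simp
    qed
  qed
  also have "\<dots> = ennreal (2 * pi * (- ((1 + r\<^sup>2 - 2 * r * 1) * sqrt (1 + r\<^sup>2 - 2 * r * 1)) / (3 * r) - (1 - r) * \<bar>1 - r\<bar> / 2)
     - 2 * pi * (- ((1 + r\<^sup>2 - 2 * r * (-1)) * sqrt (1 + r\<^sup>2 - 2 * r * (-1))) / (3 * r) - (-1 - r) * \<bar>-1 - r\<bar> / 2))"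
  proof (rule nn_integral_FTC_interior[where S = "{r}" and a = "-1" and b = 1 and
        F = "\<lambda>a. 2 * pi * (- ((1 + r\<^sup>2 - 2 * r * a) * sqrt (1 + r\<^sup>2 - 2 * r * a)) / (3 * r) - (a - r) * \<bar>a - r\<bar> / 2)"])
    show "continuous_on {-1..1} (\<lambda>a. 2 * pi * (- ((1 + r\<^sup>2 - 2 * r * a) * sqrt (1 + r\<^sup>2 - 2 * r * a)) / (3 * r) - (a - r) * \<bar>a - r\<bar> / 2))"
      using r by (intro continuous_intros) auto
  next
    fix a
    assume a: "a \<in> {-1<..<1} - {r}"
    have "(1 - r)\<^sup>2 < 1 + r\<^sup>2 - 2 * r * a"
      using a r by (simp add: power2_diff)
    then have p: "0 < 1 + r\<^sup>2 - 2 * r * a"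
      using zero_le_power2[of "1 - r"] by linarith
    have 1: "DERIV (\<lambda>a. (1 + r\<^sup>2 - 2 * r * a) * sqrt (1 + r\<^sup>2 - 2 * r * a)) a :> - (3 * r) * sqrt (1 + r\<^sup>2 - 2 * r * a)"
    proof -
      have "DERIV (\<lambda>a. (1 + r\<^sup>2 - 2 * r * a) * sqrt (1 + r\<^sup>2 - 2 * r * a)) a
        :> (- 2 * r) * sqrt (1 + r\<^sup>2 - 2 * r * a) + (1 + r\<^sup>2 - 2 * r * a) * (- r / sqrt (1 + r\<^sup>2 - 2 * r * a))"
        using p by (auto intro!: derivative_eq_intros simp: field_simps)
      also have "(1 + r\<^sup>2 - 2 * r * a) * (- r / sqrt (1 + r\<^sup>2 - 2 * r * a)) = - r * sqrt (1 + r\<^sup>2 - 2 * r * a)"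
        using real_div_sqrt[of "1 + r\<^sup>2 - 2 * r * a"] p by (simp add: field_simps)
      finally show ?thesis
        by (simp add: algebra_simps)
    qed
    have 2: "DERIV (\<lambda>a. (a - r) * \<bar>a - r\<bar>) a :> 2 * \<bar>a - r\<bar>"
    proof (cases "a < r")
      case True
      have "DERIV (\<lambda>a. - (a - r)\<^sup>2) a :> 2 * \<bar>a - r\<bar>"
        using True by (auto intro!: derivative_eq_intros)
      then show ?thesis
        by (rule has_field_derivative_transform_within_open[where S = "{..<r}"])
          (use True in \<open>auto simp: power2_eq_square algebra_simps\<close>)
    next
      case False
      have "DERIV (\<lambda>a. (a - r)\<^sup>2) a :> 2 * \<bar>a - r\<bar>"
        using False by (auto intro!: derivative_eq_intros)
      then show ?thesis
        by (rule has_field_derivative_transform_within_open[where S = "{r<..}"])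
          (use False a in \<open>auto simp: power2_eq_square\<close>)
    qed
    have "DERIV (\<lambda>a. 2 * pi * (- ((1 + r\<^sup>2 - 2 * r * a) * sqrt (1 + r\<^sup>2 - 2 * r * a)) / (3 * r) - (a - r) * \<bar>a - r\<bar> / 2)) a
        :> 2 * pi * (- (- (3 * r) * sqrt (1 + r\<^sup>2 - 2 * r * a)) / (3 * r) - 2 * \<bar>a - r\<bar> / 2)"
      by (intro DERIV_cmult DERIV_diff DERIV_cdivide DERIV_minus 1 2)
    then show "DERIV (\<lambda>a. 2 * pi * (- ((1 + r\<^sup>2 - 2 * r * a) * sqrt (1 + r\<^sup>2 - 2 * r * a)) / (3 * r) - (a - r) * \<bar>a - r\<bar> / 2)) a
        :> 2 * pi * (sqrt (1 + r\<^sup>2 - 2 * r * a) - \<bar>a - r\<bar>)"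
      using r by simp
  next
    fix a :: real
    assume "a \<in> {-1..1}"
    then have "a\<^sup>2 \<le> 1"
      by (simp add: abs_square_le_1 abs_le_iff)
    then have "\<bar>a - r\<bar> \<le> sqrt (1 + r\<^sup>2 - 2 * r * a)"
      by (intro real_le_rsqrt) (simp add: power2_diff)
    then show "0 \<le> 2 * pi * (sqrt (1 + r\<^sup>2 - 2 * r * a) - \<bar>a - r\<bar>)"
      by simp
  qed auto
  also have "2 * pi * (- ((1 + r\<^sup>2 - 2 * r * 1) * sqrt (1 + r\<^sup>2 - 2 * r * 1)) / (3 * r) - (1 - r) * \<bar>1 - r\<bar> / 2)
     - 2 * pi * (- ((1 + r\<^sup>2 - 2 * r * (-1)) * sqrt (1 + r\<^sup>2 - 2 * r * (-1))) / (3 * r) - (-1 - r) * \<bar>-1 - r\<bar> / 2)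
    = 2 * pi * (1 - r\<^sup>2 / 3)"
  proof -
    have "1 + r\<^sup>2 - 2 * r * 1 = (1 - r)\<^sup>2" "1 + r\<^sup>2 - 2 * r * (-1) = (1 + r)\<^sup>2"
      by (simp_all add: power2_diff power2_sum)
    then have "sqrt (1 + r\<^sup>2 - 2 * r * 1) = 1 - r" "sqrt (1 + r\<^sup>2 - 2 * r * (-1)) = 1 + r"
      using r by simp_all
    moreover have "\<bar>1 - r\<bar> = 1 - r" "\<bar>-1 - r\<bar> = 1 + r"
      using r by auto
    moreover have "- ((1 + r\<^sup>2 - 2 * r * 1) * (1 - r)) / (3 * r) - (1 - r) * (1 - r) / 2
      - (- ((1 + r\<^sup>2 - 2 * r * (-1)) * (1 + r)) / (3 * r) - (-1 - r) * (1 + r) / 2) = 1 - r\<^sup>2 / 3"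
      using r by (simp add: field_simps power2_eq_square power3_eq_cube)
    ultimately show ?thesis
      by (simp only: right_diff_distrib[symmetric])
  qed
  finally show ?thesis
    by (simp add: r_def)
qed

lemma potential_unit_ball:
  fixes f :: "phase \<Rightarrow> real"
  assumes meas: "f \<in> borel_measurable borel"
    and rho: "AE y in lborel. rho f y = 3 / (4 * pi) * indicator (cball 0 1) y"
    and x: "x \<noteq> 0" "norm x < 1"
  shows "potential f x = (norm x)\<^sup>2 / 2 - 3 / 2"
proof -
  let ?g = "\<lambda>y. indicator (cball 0 1) y / norm (x - y) :: real"
  have [measurable]: "(\<lambda>y. norm (x - y)) \<in> borel_measurable borel" "cball 0 (1 :: real) \<in> sets (borel :: (real ^ 3) measure)"
    by (auto intro!: borel_measurable_continuous_onI continuous_intros)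
  have g [measurable]: "?g \<in> borel_measurable borel"
    by measurable
  have "potential f x = - (LINT y|lborel. 3 / (4 * pi) * ?g y)"
  proof -
    have f: "(\<lambda>p. f (fst p, snd p)) \<in> borel_measurable (lborel \<Otimes>\<^sub>M lborel)"
      using meas by (simp add: lborel_prod)
    have [measurable]: "rho f \<in> borel_measurable borel"
      using lborel.borel_measurable_lebesgue_integral[of "\<lambda>x v. f (x, v)" lborel] f
      unfolding rho_def by (simp add: split_beta' cong: measurable_cong_sets)
    have "(LINT y|lborel. rho f y / norm (x - y)) = (LINT y|lborel. 3 / (4 * pi) * ?g y)"
    proof (rule integral_cong_AE)
      show "AE y in lborel. rho f y / norm (x - y) = 3 / (4 * pi) * ?g y"
        using rho by eventually_elim simp
    qed measurable
    then show ?thesis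
      by (simp add: potential_def)
  qed
  also have "\<dots> = - (3 / (4 * pi) * (LINT y|lborel. ?g y))"
    by (simp only: integral_mult_right_zero)
  also have "(LINT y|lborel. ?g y) = 2 * pi * (1 - (norm x)\<^sup>2 / 3)"
  proof (subst integral_eq_nn_integral)
    have "(norm x)\<^sup>2 \<le> 1"
      using x by (simp add: power_le_one)
    then show "enn2real (\<integral>\<^sup>+y. ennreal (?g y) \<partial>lborel) = 2 * pi * (1 - (norm x)\<^sup>2 / 3)"
      by (simp add: nn_integral_inverse_distance_unit_ball[OF x])
  qed (use g in auto)
  also have "- (3 / (4 * pi) * (2 * pi * (1 - (norm x)\<^sup>2 / 3))) = (norm x)\<^sup>2 / 2 - 3 / 2"
    by (simp add: field_simps)
  finally show ?thesis .
qed

section \<open>The harmonic force inside the unit ball\<close>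

lemma gradient_eqI:
  assumes "GDERIV f x :> d"
  shows "gradient f x = d"
  unfolding gradient_def
proof (rule the_equality)
  fix d'
  assume "GDERIV f x :> d'"
  then have "(\<lambda>h. h \<bullet> d') = (\<lambda>h. h \<bullet> d)"
    using assms unfolding gderiv_def by (rule has_derivative_unique)
  then have "(d' - d) \<bullet> d' = (d' - d) \<bullet> d"
    by metis
  then show "d' = d"
    by (metis inner_diff_right inner_eq_zero_iff right_minus_eq)
qed (rule assms)

lemma gradient_potential_unit_ball:
  fixes f :: "phase \<Rightarrow> real"
  assumes meas: "f \<in> borel_measurable borel"
    and rho: "AE y in lborel. rho f y = 3 / (4 * pi) * indicator (cball 0 1) y"
    and x: "x \<noteq> 0" "norm x < 1"
  shows "gradient (potential f) x = x"
proof (rule gradient_eqI)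
  have "((\<lambda>x. (norm x)\<^sup>2 / 2 - 3 / 2) has_derivative (\<lambda>h. h \<bullet> x)) (at x)"
    unfolding power2_norm_eq_inner
    by (auto intro!: derivative_eq_intros simp: inner_commute)
  \<comment> \<open>The formula for the potential holds on this open set, hence near
    \<open>x\<close>, which is all that the derivative sees.\<close>
  moreover have "open (ball 0 1 - {0 :: real ^ 3})"
    by (intro open_Diff) auto
  ultimately show "GDERIV (potential f) x :> x"
    unfolding gderiv_def
    by (rule has_derivative_transform_within_open)
      (use x potential_unit_ball[OF meas rho] in auto)
qed

subsection \<open>Rotations of phase space\<close>

lemma nn_integral_lborel_pair_swap:
  fixes G :: "'a::euclidean_space \<times> 'b::euclidean_space \<Rightarrow> ennreal"
  assumes "G \<in> borel_measurable borel"
  shows "(\<integral>\<^sup>+p. G p \<partial>lborel) = (\<integral>\<^sup>+b. \<integral>\<^sup>+a. G (a, b) \<partial>lborel \<partial>lborel)"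
proof -
  have "G \<in> borel_measurable (lborel \<Otimes>\<^sub>M lborel)"
    unfolding lborel_prod using assms by simp
  from lborel_pair.nn_integral_snd[OF this] show ?thesis
    by (simp add: lborel_prod)
qed

lemma nn_integral_lborel_translate:
  fixes g :: "'a::euclidean_space \<Rightarrow> ennreal"
  assumes "g \<in> borel_measurable borel"
  shows "(\<integral>\<^sup>+x. g (x + c) \<partial>lborel) = (\<integral>\<^sup>+x. g x \<partial>lborel)"
proof -
  have "(\<integral>\<^sup>+x. g x \<partial>lborel) = (\<integral>\<^sup>+x. g x \<partial>distr lborel borel ((+) c))"
    by (simp add: lborel_distr_plus)
  also have "\<dots> = (\<integral>\<^sup>+x. g (c + x) \<partial>lborel)"
    using assms by (subst nn_integral_distr) auto
  finally show ?thesis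
    by (simp add: add.commute)
qed

text \<open>A shear translates each fibre by a vector depending only on the other variable, so
  Tonelli's theorem and translation invariance give the claim.\<close>

lemma distr_lborel_shear:
  fixes a :: real
  shows "distr lborel borel (\<lambda>(x, v). (x + a *\<^sub>R v, v)) = (lborel :: ('a::euclidean_space \<times> 'a) measure)"
    and "distr lborel borel (\<lambda>(x, v). (x, v + a *\<^sub>R x)) = (lborel :: ('a \<times> 'a) measure)"
proof -
  let ?S = "\<lambda>(x, v). (x + a *\<^sub>R v, v) :: 'a \<times> 'a" and ?T = "\<lambda>(x, v). (x, v + a *\<^sub>R x) :: 'a \<times> 'a"
  have m: "?S \<in> borel_measurable borel" "?T \<in> borel_measurable borel"
    by (intro borel_measurable_continuous_onI; simp add: split_beta'; intro continuous_intros)+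
  have sec: "(\<lambda>x. indicator A (x, v)) \<in> borel_measurable borel" "(\<lambda>x. indicator A (v, x)) \<in> borel_measurable borel"
    if "A \<in> sets borel" for A :: "('a \<times> 'a) set" and v
    by (rule measurable_compose[OF _ borel_measurable_indicator[OF that]],
        intro borel_measurable_continuous_onI continuous_intros)+
  show "distr lborel borel ?S = lborel"
  proof (rule measure_eqI)
    fix A
    assume "A \<in> sets (distr lborel borel ?S)"
    then have A: "A \<in> sets borel"
      by simp
    have "emeasure (distr lborel borel ?S) A = (\<integral>\<^sup>+z. indicator A z \<partial>distr lborel borel ?S)"
      using A by simp
    also have "\<dots> = (\<integral>\<^sup>+z. indicator A (?S z) \<partial>lborel)"
      using A m by (intro nn_integral_distr) auto
    also have "\<dots> = (\<integral>\<^sup>+v. \<integral>\<^sup>+x. indicator A (x + a *\<^sub>R v, v) \<partial>lborel \<partial>lborel)"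
      using A m by (subst nn_integral_lborel_pair_swap) (auto intro!: measurable_compose[OF m(1)])
    also have "\<dots> = (\<integral>\<^sup>+v. \<integral>\<^sup>+x. indicator A (x, v) \<partial>lborel \<partial>lborel)"
      by (intro nn_integral_cong nn_integral_lborel_translate sec A)
    also have "\<dots> = emeasure lborel A"
      using A by (subst nn_integral_lborel_pair_swap[symmetric]) auto
    finally show "emeasure (distr lborel borel ?S) A = emeasure lborel A" .
  qed simp
  show "distr lborel borel ?T = lborel"
  proof (rule measure_eqI)
    fix A
    assume "A \<in> sets (distr lborel borel ?T)"
    then have A: "A \<in> sets borel"
      by simp
    have "emeasure (distr lborel borel ?T) A = (\<integral>\<^sup>+z. indicator A z \<partial>distr lborel borel ?T)"
      using A by simp
    also have "\<dots> = (\<integral>\<^sup>+z. indicator A (?T z) \<partial>lborel)"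
      using A m by (intro nn_integral_distr) auto
    also have "\<dots> = (\<integral>\<^sup>+x. \<integral>\<^sup>+v. indicator A (x, v + a *\<^sub>R x) \<partial>lborel \<partial>lborel)"
      using A m by (subst nn_integral_lborel_pair) (auto intro!: measurable_compose[OF m(2)])
    also have "\<dots> = (\<integral>\<^sup>+x. \<integral>\<^sup>+v. indicator A (x, v) \<partial>lborel \<partial>lborel)"
      by (intro nn_integral_cong nn_integral_lborel_translate sec A)
    also have "\<dots> = emeasure lborel A"
      using A by (subst nn_integral_lborel_pair[symmetric]) auto
    finally show "emeasure (distr lborel borel ?T) A = emeasure lborel A" .
  qed simp
qed

definition phase_rotation :: "real \<Rightarrow> 'a::real_vector \<times> 'a \<Rightarrow> 'a \<times> 'a" where
  "phase_rotation t z = (cos t *\<^sub>R fst z + sin t *\<^sub>R snd z, cos t *\<^sub>R snd z - sin t *\<^sub>R fst z)"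

text \<open>The right-hand side of the characteristic system \<open>x' = v\<close>,
  \<open>v' = - x\<close>, whose flow is \<open>phase_rotation\<close>.\<close>

definition hamiltonian_field :: "'a::real_vector \<times> 'a \<Rightarrow> 'a \<times> 'a" where
  "hamiltonian_field z = (snd z, - fst z)"

lemma phase_rotation_measurable [measurable]:
  "phase_rotation t \<in> borel_measurable (borel :: ('a::euclidean_space \<times> 'a) measure)"
  unfolding phase_rotation_def by (intro borel_measurable_continuous_onI continuous_intros)

lemma phase_rotation_0 [simp]: "phase_rotation 0 z = z"
  by (simp add: phase_rotation_def)

lemma norm_phase_rotation [simp]:
  fixes z :: "'a::real_inner \<times> 'a"
  shows "norm (phase_rotation t z) = norm z"
proof -
  have "c * (c * a) + (c * (c * b) + (s * (s * a) + s * (s * b))) = (s\<^sup>2 + c\<^sup>2) * (a + b)" for a b c s :: real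
    by (simp add: algebra_simps power2_eq_square)
  from this[of "cos t" _ _ "sin t"]
  have "cos t * (cos t * a) + (cos t * (cos t * b) + (sin t * (sin t * a) + sin t * (sin t * b))) = a + b" for a b
    by simp
  moreover have "phase_rotation t z \<bullet> phase_rotation t z
      = cos t * (cos t * (fst z \<bullet> fst z)) + (cos t * (cos t * (snd z \<bullet> snd z))
        + (sin t * (sin t * (fst z \<bullet> fst z)) + sin t * (sin t * (snd z \<bullet> snd z))))"
    by (simp add: phase_rotation_def inner_prod_def inner_add_left inner_add_right inner_diff_left
        inner_diff_right inner_commute[of "snd z" "fst z"] algebra_simps)
  ultimately have "phase_rotation t z \<bullet> phase_rotation t z = z \<bullet> z"
    by (simp add: inner_prod_def)
  then show ?thesis
    by (simp add: norm_eq_sqrt_inner)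
qed

lemma has_vector_derivative_phase_rotation:
  fixes z :: "'a::real_normed_vector \<times> 'a"
  shows "((\<lambda>t. phase_rotation t z) has_vector_derivative hamiltonian_field (phase_rotation t z)) (at t)"
  unfolding phase_rotation_def hamiltonian_field_def
  by (auto intro!: derivative_eq_intros has_vector_derivative_Pair simp: algebra_simps)

text \<open>A rotation is a product of three shears.\<close>

lemma distr_lborel_phase_rotation:
  assumes t: "0 < t" "t < pi"
  shows "distr lborel borel (phase_rotation t) = (lborel :: ('a::euclidean_space \<times> 'a) measure)"
proof -
  \<comment> \<open>This is \<open>tan (t / 2)\<close>, the parameter for which \<open>?S\<close>,
    \<open>?T\<close>, \<open>?S\<close> in succession give the rotation; the division needs
    \<open>sin t\<close> nonzero, whence the range of \<open>t\<close>.\<close>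
  define a where "a = (1 - cos t) / sin t"
  have s: "sin t > 0"
    using t by (rule sin_gt_zero)
  let ?S = "\<lambda>(x, v). (x + a *\<^sub>R v, v) :: 'a \<times> 'a" and ?T = "\<lambda>(x, v). (x, v + (- sin t) *\<^sub>R x) :: 'a \<times> 'a"
  have m: "?S \<in> borel_measurable borel" "?T \<in> borel_measurable borel"
    by (intro borel_measurable_continuous_onI; simp add: split_beta'; intro continuous_intros)+
  have as: "a * sin t = 1 - cos t"
    using s by (simp add: a_def)
  have ac: "a + a * cos t = sin t"
  proof -
    have "(1 - cos t) * (1 + cos t) = sin t * sin t"
      using sin_cos_squared_add[of t] by (simp add: algebra_simps power2_eq_square)
    then have "a * (1 + cos t) = sin t"
      using s by (simp add: a_def)
    then show ?thesis
      by (simp add: algebra_simps)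
  qed
  have "?S (?T (?S z)) = phase_rotation t z" for z
  proof -
    obtain x v where z: "z = (x, v)"
      by fastforce
    have v: "v - sin t *\<^sub>R (x + a *\<^sub>R v) = cos t *\<^sub>R v - sin t *\<^sub>R x"
      using as by (simp add: algebra_simps) (metis add_diff_cancel_left' diff_add_cancel mult.commute scaleR_left_diff_distrib scaleR_one)
    have "x + a *\<^sub>R v + a *\<^sub>R (cos t *\<^sub>R v - sin t *\<^sub>R x) = (1 - a * sin t) *\<^sub>R x + (a + a * cos t) *\<^sub>R v"
      by (simp add: algebra_simps)
    also have "\<dots> = cos t *\<^sub>R x + sin t *\<^sub>R v"
      unfolding as ac by simp
    finally show ?thesis
      using v by (simp add: z phase_rotation_def)
  qed
  then have "distr lborel borel (phase_rotation t) = distr lborel borel (?S \<circ> (?T \<circ> ?S))"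
    by (simp add: comp_def)
  also have "\<dots> = distr (distr lborel borel (?T \<circ> ?S)) borel ?S"
    using m by (intro distr_distr[symmetric]) auto
  also have "distr lborel borel (?T \<circ> ?S) = distr (distr lborel borel ?S) borel ?T"
    using m by (intro distr_distr[symmetric]) auto
  finally show ?thesis
    by (simp only: distr_lborel_shear)
qed

section \<open>Test functions and rotation-invariant densities\<close>

lemma test_function_differentiable:
  assumes "test_function \<phi>"
  shows "(\<phi> has_derivative frechet_derivative \<phi> (at z)) (at z)"
    and "continuous_on UNIV (\<lambda>z. frechet_derivative \<phi> (at z) h)"
proof -
  have "Ck 1 \<phi>"
    using assms by (simp add: test_function_def)
  then have C: "\<phi> differentiable_on UNIV" "\<And>h. continuous_on UNIV (\<lambda>z. frechet_derivative \<phi> (at z) h)"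
    by simp_all
  then show "(\<phi> has_derivative frechet_derivative \<phi> (at z)) (at z)"
    by (simp add: differentiable_on_def frechet_derivative_works)
  show "continuous_on UNIV (\<lambda>z. frechet_derivative \<phi> (at z) h)"
    by (rule C(2))
qed

text \<open>Turns a derivative in a direction that varies with the point into derivatives in fixed
  directions, for which \<open>Ck\<close> gives continuity.\<close>

lemma linear_eq_sum_Basis:
  fixes g :: "'a::euclidean_space \<Rightarrow> real"
  assumes "linear g"
  shows "g h = (\<Sum>b\<in>Basis. (h \<bullet> b) * g b)"
proof -
  have "g h = g (\<Sum>b\<in>Basis. (h \<bullet> b) *\<^sub>R b)"
    by (simp add: euclidean_representation)
  also have "\<dots> = (\<Sum>b\<in>Basis. (h \<bullet> b) * g b)"
    using assms by (simp add: linear_sum linear_cmul)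
  finally show ?thesis .
qed

lemma inner_gradient:
  fixes g :: "'a::euclidean_space \<Rightarrow> real"
  assumes g: "(g has_derivative g') (at x)"
  shows "h \<bullet> gradient g x = g' h"
proof -
  have lin: "linear g'"
    using g by (rule has_derivative_linear)
  let ?d = "\<Sum>b\<in>Basis. g' b *\<^sub>R b"
  have "h \<bullet> ?d = g' h" for h
    unfolding linear_eq_sum_Basis[OF lin, of h]
    by (simp add: inner_sum_right mult.commute)
  moreover from this have "GDERIV g x :> ?d"
    using g by (simp add: gderiv_def)
  ultimately show ?thesis
    by (simp add: gradient_eqI)
qed

text \<open>Both \<open>f\<close> and Lebesgue measure are invariant, so the integral of
  \<open>f\<close> times the rotated test function does not change with the angle; its derivative at
  angle 0 is the stated integral. Dominated convergence of difference quotients justifies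
  differentiating under the integral.\<close>

lemma integral_rotation_invariant:
  fixes f \<phi> :: "'a::euclidean_space \<times> 'a \<Rightarrow> real"
  assumes f: "integrable lborel f" and inv: "\<And>t z. f (phase_rotation t z) = f z"
    and supp: "\<And>z. f z \<noteq> 0 \<Longrightarrow> norm z \<le> R"
    and \<phi>: "test_function \<phi>"
  shows "(LINT z|lborel. f z * frechet_derivative \<phi> (at z) (hamiltonian_field z)) = 0"
proof -
  define H where "H z = frechet_derivative \<phi> (at z) (hamiltonian_field z)" for z
  have \<phi>': "(\<phi> has_derivative frechet_derivative \<phi> (at z)) (at z)" for z
    by (rule test_function_differentiable[OF \<phi>])
  have "H z = (\<Sum>b\<in>Basis. (hamiltonian_field z \<bullet> b) * frechet_derivative \<phi> (at z) b)" for z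
    unfolding H_def using has_derivative_linear[OF \<phi>'] by (rule linear_eq_sum_Basis)
  then have "continuous_on UNIV H"
    unfolding hamiltonian_field_def
    by (auto intro!: continuous_intros test_function_differentiable(2)[OF \<phi>] cong: continuous_on_cong)
  have c\<phi>: "continuous_on UNIV \<phi>"
    using \<phi>' by (meson continuous_at_imp_continuous_on has_derivative_continuous)
  \<comment> \<open>Bounds on \<open>cball 0 R\<close> are enough, because \<open>f\<close> vanishes
    outside it and rotations preserve the norm.\<close>
  obtain C where C: "\<And>z. norm z \<le> R \<Longrightarrow> \<bar>H z\<bar> \<le> C"
  proof -
    have "bounded (H ` cball 0 R)"
      using \<open>continuous_on UNIV H\<close> by (intro compact_imp_bounded compact_continuous_image) (auto intro: continuous_on_subset)
    then show ?thesis
      using that unfolding bounded_iff by (metis image_eqI mem_cball_0 real_norm_def)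
  qed
  obtain B where B: "\<And>z. norm z \<le> R \<Longrightarrow> \<bar>\<phi> z\<bar> \<le> B"
  proof -
    have "bounded (\<phi> ` cball 0 R)"
      using c\<phi> by (intro compact_imp_bounded compact_continuous_image) (auto intro: continuous_on_subset)
    then show ?thesis
      using that unfolding bounded_iff by (metis image_eqI mem_cball_0 real_norm_def)
  qed
  have meas [measurable]: "f \<in> borel_measurable borel" "\<phi> \<in> borel_measurable borel" "H \<in> borel_measurable borel"
    using borel_measurable_integrable[OF f] \<open>continuous_on UNIV H\<close> c\<phi>
    by (auto intro: borel_measurable_continuous_onI)
  have int: "integrable lborel (\<lambda>z. f z * \<phi> z)"
  proof (rule Bochner_Integration.integrable_bound)
    show "integrable lborel (\<lambda>z. B * f z)"
      using f by simp
    have "\<bar>f z * \<phi> z\<bar> \<le> \<bar>B * f z\<bar>" for z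
    proof (cases "f z = 0")
      case False
      then have "\<bar>\<phi> z\<bar> \<le> \<bar>B\<bar>"
        using B[of z] supp[of z] by linarith
      then show ?thesis
        by (simp add: abs_mult mult.commute mult_right_mono)
    qed simp
    then show "AE z in lborel. norm (f z * \<phi> z) \<le> norm (B * f z)"
      by simp
  qed simp
  \<comment> \<open>Angles tending to 0 within the range in which invariance of the measure was
    shown.\<close>
  define \<tau> where "\<tau> n = inverse (real (Suc n))" for n
  have \<tau>: "0 < \<tau> n" "\<tau> n < pi" for n
  proof -
    show "0 < \<tau> n"
      by (simp add: \<tau>_def)
    have "\<tau> n \<le> 1"
      by (simp add: \<tau>_def inverse_le_1_iff)
    then show "\<tau> n < pi"
      using pi_gt3 by linarith
  qed
  have deriv: "((\<lambda>t. \<phi> (phase_rotation t z)) has_real_derivative H (phase_rotation t z)) (at t)" for z t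
  proof -
    have "((\<lambda>t. phase_rotation t z) has_derivative (\<lambda>h. h *\<^sub>R hamiltonian_field (phase_rotation t z))) (at t)"
      using has_vector_derivative_phase_rotation[of z t] by (simp add: has_vector_derivative_def)
    from has_derivative_compose[OF this \<phi>']
    show ?thesis
      using linear_cmul[OF has_derivative_linear[OF \<phi>']]
      by (simp add: has_field_derivative_def H_def mult.commute[of _ "frechet_derivative _ _ _"] mult_commute_abs)
  qed
  define q where "q n z = (\<phi> (phase_rotation (\<tau> n) z) - \<phi> z) / \<tau> n" for n z
  have q_bound: "\<bar>q n z\<bar> \<le> C" if "norm z \<le> R" for n z
  proof -
    \<comment> \<open>The mean value theorem writes the quotient as \<open>H\<close> at a rotated
      point of the same norm, so the bound does not depend on \<open>n\<close>.\<close>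
    obtain \<xi> where "\<phi> (phase_rotation (\<tau> n) z) - \<phi> (phase_rotation 0 z) = (\<tau> n - 0) * H (phase_rotation \<xi> z)"
      using MVT2[of 0 "\<tau> n" "\<lambda>t. \<phi> (phase_rotation t z)" "\<lambda>t. H (phase_rotation t z)"] \<tau>(1) deriv by blast
    then have "q n z = H (phase_rotation \<xi> z)"
      using \<tau>(1)[of n] by (simp add: q_def)
    then show ?thesis
      using C[of "phase_rotation \<xi> z"] that by simp
  qed
  have q_lim: "(\<lambda>n. q n z) \<longlonglongrightarrow> H z" for z
  proof -
    have "((\<lambda>h. (\<phi> (phase_rotation (0 + h) z) - \<phi> (phase_rotation 0 z)) / h) \<longlongrightarrow> H z) (at 0)"
      using deriv[of z 0] by (simp add: DERIV_def)
    moreover have "filterlim \<tau> (at 0) sequentially"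
      unfolding filterlim_at \<tau>_def using LIMSEQ_inverse_real_of_nat by simp
    ultimately show ?thesis
      unfolding q_def by (auto dest: filterlim_compose)
  qed
  have zero: "(LINT z|lborel. f z * q n z) = 0" for n
  proof -
    let ?r = "phase_rotation (\<tau> n) :: 'a \<times> 'a \<Rightarrow> 'a \<times> 'a"
    have d: "distr lborel borel ?r = lborel"
      by (rule distr_lborel_phase_rotation[OF \<tau>])
    have "(LINT z|lborel. f z * \<phi> z) = (LINT z|distr lborel borel ?r. f z * \<phi> z)"
      by (simp add: d)
    also have "\<dots> = (LINT z|lborel. f z * \<phi> (?r z))"
      by (subst integral_distr) (simp_all add: inv)
    finally have eq: "(LINT z|lborel. f z * \<phi> (?r z)) = (LINT z|lborel. f z * \<phi> z)" ..
    have "integrable (distr lborel borel ?r) (\<lambda>z. f z * \<phi> z)"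
      using int by (simp add: d)
    then have int': "integrable lborel (\<lambda>z. f z * \<phi> (?r z))"
      by (subst (asm) integrable_distr_eq) (simp_all add: inv)
    have "(LINT z|lborel. f z * q n z) = (LINT z|lborel. (f z * \<phi> (?r z) - f z * \<phi> z) / \<tau> n)"
      by (simp add: q_def right_diff_distrib)
    also have "\<dots> = 0"
      using int int' eq by simp
    finally show ?thesis .
  qed
  have "(\<lambda>n. LINT z|lborel. f z * q n z) \<longlonglongrightarrow> (LINT z|lborel. f z * H z)"
  proof (rule integral_dominated_convergence)
    show "integrable lborel (\<lambda>z. C * \<bar>f z\<bar>)"
      using f by simp
    show "AE z in lborel. (\<lambda>n. f z * q n z) \<longlonglongrightarrow> f z * H z"
      by (intro AE_I2 tendsto_mult_left q_lim)
    have "\<bar>f z * q n z\<bar> \<le> C * \<bar>f z\<bar>" for n z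
    proof (cases "f z = 0")
      case False
      then show ?thesis
        using q_bound[OF supp[OF False], of n] by (simp add: abs_mult mult.commute mult_left_mono)
    qed simp
    then show "AE z in lborel. norm (f z * q n z) \<le> C * \<bar>f z\<bar>" for n
      by simp
  qed (unfold q_def, measurable)
  then have "(LINT z|lborel. f z * H z) = 0"
    unfolding zero by (simp add: LIMSEQ_const_iff)
  then show ?thesis
    by (simp add: H_def)
qed

subsection \<open>The weak solution and its support\<close>

text \<open>On expansion \<open>cross3 x x\<close> and \<open>cross3 v v\<close> vanish, and
  \<open>cross3 x v\<close> is left with the determinant of the rotation, which is 1.\<close>

lemma ang_sq_phase_rotation [simp]: "ang_sq (phase_rotation t z) = ang_sq z"
proof -
  obtain x v where z: "z = (x, v)"
    by fastforce
  have "cross3 (cos t *\<^sub>R x + sin t *\<^sub>R v) (cos t *\<^sub>R v - sin t *\<^sub>R x)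
      = (cos t * cos t) *\<^sub>R cross3 x v - (sin t * sin t) *\<^sub>R cross3 v x"
    by (simp add: cross_add_left cross_add_right cross_mult_left cross_mult_right
        left_diff_distrib right_diff_distrib Cross3.right_diff_distrib)
  also have "\<dots> = ((sin t)\<^sup>2 + (cos t)\<^sup>2) *\<^sub>R cross3 x v"
    by (subst cross_skew[of v x]) (simp only: scaleR_left_distrib power2_eq_square, simp)
  finally show ?thesis
    by (simp add: z ang_sq_def phase_rotation_def)
qed

lemma ball_solution_phase_rotation: "ball_solution \<Gamma> (phase_rotation t z) = ball_solution \<Gamma> z"
proof -
  have d: "defect z = 1 - (norm z)\<^sup>2 + ang_sq z" for z
    by (cases z) (simp add: defect_def norm_Pair)
  show ?thesis
    by (simp add: ball_solution_def d)
qed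

lemma ball_solution_support:
  assumes "\<Gamma> < 1" "ball_solution \<Gamma> (x, v) \<noteq> 0"
  shows "norm x < 1" "norm v \<le> 1"
proof -
  have "0 < defect (x, v)" "ang_sq (x, v) < 1"
    using assms by (auto simp: ball_solution_def profile_def split: if_splits)
  then show "norm x < 1" "norm v \<le> 1"
    using norm_le_1_of_defect[of x v] by auto
qed

lemma rho_ball_solution:
  assumes \<Gamma>: "1 - 1 / 2 ^ 12 \<le> \<Gamma>" "\<Gamma> < 1"
  shows "AE x in lborel. rho (ball_solution \<Gamma>) x = 3 / (4 * pi) * indicator (cball 0 1) x"
proof -
  \<comment> \<open>On the unit sphere \<open>rho\<close> is 0 while the indicator is 1, so this
    null set is removed.\<close>
  have "sphere (0 :: real ^ 3) 1 \<in> null_sets lebesgue"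
    using negligible_sphere[of "0 :: real ^ 3" 1] by (simp add: negligible_iff_null_sets)
  then have "sphere (0 :: real ^ 3) 1 \<in> null_sets lborel"
    by (simp add: null_sets_completion_iff)
  then have "AE x :: real ^ 3 in lborel. x \<notin> sphere 0 1"
    by (rule AE_not_in)
  then show ?thesis
    using AE_lborel_singleton[of "0 :: real ^ 3"]
  proof eventually_elim
    case (elim x)
    show ?case
    proof (cases "norm x < 1")
      case True
      have m: "(\<lambda>v. ball_solution \<Gamma> (x, v)) \<in> borel_measurable borel"
        by (rule measurable_compose[OF _ ball_solution_measurable])
          (intro borel_measurable_continuous_onI continuous_intros)
      have "rho (ball_solution \<Gamma>) x = enn2real (\<integral>\<^sup>+v. ennreal (ball_solution \<Gamma> (x, v)) \<partial>lborel)"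
        unfolding rho_def using m by (intro integral_eq_nn_integral) (simp_all add: ball_solution_nonneg[OF \<Gamma>])
      then show ?thesis
        using elim True by (simp add: nn_integral_ball_solution[OF \<Gamma>])
    next
      case False
      then have "ball_solution \<Gamma> (x, v) = 0" for v
        using ball_solution_support[of \<Gamma> x v] \<Gamma> by auto
      then show ?thesis
        using False elim by (simp add: rho_def)
    qed
  qed
qed

text \<open>\<open>ball_solution\<close> is unbounded near \<open>defect z = 0\<close>, so
  integrability is drawn from the velocity integrals by Tonelli's theorem.\<close>

lemma integrable_ball_solution:
  assumes \<Gamma>: "1 - 1 / 2 ^ 12 \<le> \<Gamma>" "\<Gamma> < 1"
  shows "integrable lborel (ball_solution \<Gamma>)"
proof (rule integrableI_nonneg)
  have "(\<integral>\<^sup>+z. ennreal (ball_solution \<Gamma> z) \<partial>lborel)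
      = (\<integral>\<^sup>+x. \<integral>\<^sup>+v. ennreal (ball_solution \<Gamma> (x, v)) \<partial>lborel \<partial>lborel)"
    by (rule nn_integral_lborel_pair) simp
  also have "\<dots> \<le> (\<integral>\<^sup>+x. ennreal (3 / (4 * pi)) * indicator (cball 0 1) (x :: real ^ 3) \<partial>lborel)"
  proof (rule nn_integral_mono_AE)
    show "AE x in lborel. (\<integral>\<^sup>+v. ennreal (ball_solution \<Gamma> (x, v)) \<partial>lborel)
        \<le> ennreal (3 / (4 * pi)) * indicator (cball 0 1) (x :: real ^ 3)"
      using AE_lborel_singleton[of "0 :: real ^ 3"]
    proof eventually_elim
      case (elim x)
      show ?case
      proof (cases "norm x < 1")
        case True
        then show ?thesis
          using elim by (simp add: nn_integral_ball_solution[OF \<Gamma>])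
      next
        case False
        then have "ball_solution \<Gamma> (x, v) = 0" for v
          using ball_solution_support[of \<Gamma> x v] \<Gamma> by auto
        then show ?thesis
          by simp
      qed
    qed
  qed
  also have "\<dots> = ennreal (3 / (4 * pi)) * emeasure lborel (cball (0 :: real ^ 3) 1)"
    by (rule nn_integral_cmult_indicator) simp
  also have "\<dots> < \<infinity>"
    by (simp add: emeasure_cball ennreal_mult_less_top)
  finally show "(\<integral>\<^sup>+z. ennreal (ball_solution \<Gamma> z) \<partial>lborel) < \<infinity>" .
qed (use ball_solution_nonneg[OF \<Gamma>] in auto)

text \<open>Inside the ball the gradient of the potential is \<open>x\<close>, so off the null set
  \<open>x = 0\<close> the weak integrand is \<open>ball_solution\<close> times the derivative of
  \<open>\<phi>\<close> along \<open>hamiltonian_field\<close>. Its integral vanishes by rotation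
  invariance.\<close>

lemma weak_static_solution_ball_solution:
  assumes \<Gamma>: "1 - 1 / 2 ^ 12 \<le> \<Gamma>" "\<Gamma> < 1"
  shows "weak_static_solution (ball_solution \<Gamma>)"
  unfolding weak_static_solution_def
proof (intro conjI allI impI)
  let ?f = "ball_solution \<Gamma>"
  show int: "integrable lborel ?f"
    by (rule integrable_ball_solution[OF \<Gamma>])
  show "AE z in lborel. 0 \<le> ?f z"
    using ball_solution_nonneg[OF \<Gamma>] by simp
  have supp: "norm z \<le> 2" if "?f z \<noteq> 0" for z
  proof -
    have "norm (fst z) < 1" "norm (snd z) \<le> 1"
      using that ball_solution_support[of \<Gamma> "fst z" "snd z"] \<Gamma> by auto
    then show ?thesis
      using norm_Pair_le[of "fst z" "snd z"] by simp
  qed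
  then show "\<exists>K. compact K \<and> (AE z in lborel. z \<notin> K \<longrightarrow> ?f z = 0)"
    by (intro exI[of _ "cball 0 2"] conjI AE_I2) (auto simp: split_paired_all)
  have rho: "AE x in lborel. rho ?f x = 3 / (4 * pi) * indicator (cball 0 1) x"
    by (rule rho_ball_solution[OF \<Gamma>])
  then have "AE x in lborel. \<bar>rho ?f x\<bar> \<le> 3 / (4 * pi)"
    by eventually_elim (simp add: indicator_def)
  then show "\<exists>C. AE x in lborel. \<bar>rho ?f x\<bar> \<le> C" ..
  fix \<phi> :: "phase \<Rightarrow> real"
  assume \<phi>: "test_function \<phi>"
  define D\<phi> where "D\<phi> z = frechet_derivative \<phi> (at z)" for z
  have \<phi>': "(\<phi> has_derivative D\<phi> z) (at z)" for z
    unfolding D\<phi>_def by (rule test_function_differentiable[OF \<phi>])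
  have lin: "linear (D\<phi> z)" for z
    using \<phi>' by (rule has_derivative_linear)
  have gx: "h \<bullet> gradient (\<lambda>x'. \<phi> (x', v)) x = D\<phi> (x, v) (h, 0)"
    and gv: "h \<bullet> gradient (\<lambda>v'. \<phi> (x, v')) v = D\<phi> (x, v) (0, h)" for h x v
  proof -
    have "((\<lambda>x'. (x', v)) has_derivative (\<lambda>h. (h, 0))) (at x)" "((\<lambda>v'. (x, v')) has_derivative (\<lambda>h. (0, h))) (at v)"
      by (auto intro!: derivative_eq_intros)
    from this[THEN has_derivative_compose, OF \<phi>']
    show "h \<bullet> gradient (\<lambda>x'. \<phi> (x', v)) x = D\<phi> (x, v) (h, 0)"
      "h \<bullet> gradient (\<lambda>v'. \<phi> (x, v')) v = D\<phi> (x, v) (0, h)"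
      by (auto intro: inner_gradient)
  qed
  \<comment> \<open>The gradient of the potential is not computed at \<open>0\<close>; its value \<open>c\<close> there only enters measurability.\<close>
  define c where "c = gradient (potential ?f) 0"
  define m where "m x = (if x = 0 then c else x)" for x
  \<comment> \<open>Where \<open>?f\<close> vanishes both sides are 0; elsewhere
    \<open>norm x < 1\<close>, so the computed gradient applies for
    \<open>x \<noteq> 0\<close>.\<close>
  have integrand: "(case z of (x, v) \<Rightarrow> ?f (x, v) *
      (v \<bullet> gradient (\<lambda>x'. \<phi> (x', v)) x - gradient (potential ?f) x \<bullet> gradient (\<lambda>v'. \<phi> (x, v')) v))
    = ?f z * D\<phi> z (snd z, - m (fst z))" for z
  proof (cases z)
    case (Pair x v)
    have "v \<bullet> gradient (\<lambda>x'. \<phi> (x', v)) x - g \<bullet> gradient (\<lambda>v'. \<phi> (x, v')) v = D\<phi> (x, v) (v, - g)" for g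
      unfolding gx gv using linear_diff[OF lin, of "(x, v)" "(v, 0)" "(0, g)"] by simp
    moreover have "gradient (potential ?f) x = m x" if "?f (x, v) \<noteq> 0"
    proof (cases "x = 0")
      case False
      then show ?thesis
        using gradient_potential_unit_ball[OF ball_solution_measurable rho False]
          ball_solution_support(1)[OF \<Gamma>(2) that] by (simp add: m_def)
    qed (simp add: m_def c_def)
    ultimately show ?thesis
      by (cases "?f (x, v) = 0") (simp_all add: Pair)
  qed
  have [measurable]: "(\<lambda>z. D\<phi> z h) \<in> borel_measurable borel" for h
    unfolding D\<phi>_def by (intro borel_measurable_continuous_onI test_function_differentiable(2) \<phi>)
  have "(LINT (x, v)|lborel. ?f (x, v) *
           (v \<bullet> gradient (\<lambda>x'. \<phi> (x', v)) x
            - gradient (potential ?f) x \<bullet> gradient (\<lambda>v'. \<phi> (x, v')) v))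
      = (LINT z|lborel. ?f z * D\<phi> z (snd z, - m (fst z)))"
    unfolding integrand ..
  also have "\<dots> = (LINT z|lborel. ?f z * D\<phi> z (hamiltonian_field z))"
  proof (rule integral_cong_AE)
    have fs [measurable]: "(fst :: phase \<Rightarrow> real ^ 3) \<in> borel_measurable borel" "(snd :: phase \<Rightarrow> real ^ 3) \<in> borel_measurable borel"
      by (intro borel_measurable_continuous_onI continuous_intros)+
    have [measurable]: "m \<in> borel_measurable borel"
      unfolding m_def by measurable
    have "(\<lambda>z. D\<phi> z (snd z, - m (fst z))) = (\<lambda>z. \<Sum>b\<in>Basis. (snd z \<bullet> fst b - m (fst z) \<bullet> snd b) * D\<phi> z b)"
      by (subst linear_eq_sum_Basis[OF lin]) (simp add: inner_prod_def)
    also have "\<dots> \<in> borel_measurable borel"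
      by measurable
    finally show "(\<lambda>z. ?f z * D\<phi> z (snd z, - m (fst z))) \<in> borel_measurable lborel"
      by simp
    have "(\<lambda>z. D\<phi> z (hamiltonian_field z)) = (\<lambda>z. \<Sum>b\<in>Basis. (snd z \<bullet> fst b - fst z \<bullet> snd b) * D\<phi> z b)"
      by (subst linear_eq_sum_Basis[OF lin]) (simp add: inner_prod_def hamiltonian_field_def)
    also have "\<dots> \<in> borel_measurable borel"
      by measurable
    finally show "(\<lambda>z. ?f z * D\<phi> z (hamiltonian_field z)) \<in> borel_measurable lborel"
      by simp
    have "AE z :: phase in lborel \<Otimes>\<^sub>M lborel. fst z \<noteq> 0"
    proof (rule lborel_pair.AE_pair_measure)
      show "AE x in lborel. AE v in lborel. fst (x :: real ^ 3, v :: real ^ 3) \<noteq> 0"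
        using AE_lborel_singleton[of "0 :: real ^ 3"] by eventually_elim simp
      show "{z \<in> space (lborel \<Otimes>\<^sub>M lborel). fst z \<noteq> (0 :: real ^ 3)} \<in> sets (lborel \<Otimes>\<^sub>M (lborel :: (real ^ 3) measure))"
        by measurable
    qed
    then have "AE z :: phase in lborel. fst z \<noteq> 0"
      unfolding lborel_prod .
    then show "AE z in lborel. ?f z * D\<phi> z (snd z, - m (fst z)) = ?f z * D\<phi> z (hamiltonian_field z)"
      by eventually_elim (simp add: m_def hamiltonian_field_def)
  qed
  also have "\<dots> = 0"
    unfolding D\<phi>_def
    by (rule integral_rotation_invariant[OF int ball_solution_phase_rotation supp \<phi>])
  finally show "(LINT (x, v)|lborel. ?f (x, v) *
           (v \<bullet> gradient (\<lambda>x'. \<phi> (x', v)) x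
            - gradient (potential ?f) x \<bullet> gradient (\<lambda>v'. \<phi> (x, v')) v)) = 0" .
qed

section \<open>The essential support\<close>

lemma ang_sq_le: "ang_sq z \<le> (norm (fst z))\<^sup>2 * (norm (snd z))\<^sup>2"
  by (simp add: ang_sq_def norm_cross)

text \<open>On the right-hand set \<open>norm x \<le> 1\<close>, hence
  \<open>ang_sq (x, v) \<le> (norm v)\<^sup>2\<close>, which yields the middle inequality of
  \<open>D\<close>.\<close>

lemma D_eq:
  assumes "\<Gamma> < 1"
  shows "D \<Gamma> = {z. 0 \<le> defect z \<and> ang_sq z \<le> \<Gamma>}"
proof -
  have "ang_sq (x, v) - (norm x)\<^sup>2 - (norm v)\<^sup>2 \<le> 0" if "0 \<le> defect (x, v)" "ang_sq (x, v) \<le> \<Gamma>" for x v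
  proof -
    have "norm x \<le> 1"
      using norm_le_1_of_defect(1)[of x v] that assms by simp
    then have "(norm x)\<^sup>2 * (norm v)\<^sup>2 \<le> 1 * (norm v)\<^sup>2"
      by (intro mult_right_mono) (simp_all add: power_le_one)
    then show ?thesis
      using ang_sq_le[of "(x, v)"] zero_le_power2[of "norm x"] unfolding fst_conv snd_conv by linarith
  qed
  then show ?thesis
    unfolding D_def by (auto simp: defect_def ang_sq_def)
qed

text \<open>\<open>D \<Gamma>\<close> is closed and the solution vanishes outside it. Conversely,
  every neighbourhood of a point of \<open>D \<Gamma>\<close> meets the open set \<open>?P\<close>
  of positivity in a nonempty open set, which is not null.\<close>

lemma essential_support_ball_solution:
  assumes \<Gamma>: "1 - 1 / 2 ^ 12 \<le> \<Gamma>" "\<Gamma> < 1"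
  shows "essential_support (ball_solution \<Gamma>) = D \<Gamma>"
proof -
  let ?f = "ball_solution \<Gamma>"
  have "0 < \<Gamma>"
    using \<Gamma> by simp
  have "closed (D \<Gamma>)"
    unfolding D_eq[OF \<Gamma>(2)]
    by (intro closed_Collect_conj closed_Collect_le continuous_ang_sq continuous_defect continuous_intros)
  moreover have "?f z = 0" if "z \<notin> D \<Gamma>" for z
    using that unfolding D_eq[OF \<Gamma>(2)] by (auto simp: ball_solution_def profile_def)
  ultimately have "essential_support ?f \<subseteq> D \<Gamma>"
    unfolding essential_support_def by (auto intro!: exI[of _ "- D \<Gamma>"] AE_I2 simp: open_Compl)
  moreover have False if z: "z \<in> D \<Gamma>" and U: "open U" "z \<in> U" and ae: "AE z in lborel. z \<in> U \<longrightarrow> ?f z = 0" for z U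
  proof -
    have z': "0 \<le> defect z" "ang_sq z \<le> \<Gamma>"
      using z D_eq[OF \<Gamma>(2)] by auto
    let ?P = "{z. 0 < defect z} \<inter> {z. ang_sq z < \<Gamma>}"
    have oP: "open ?P"
      by (intro open_Int open_Collect_less continuous_ang_sq continuous_defect continuous_intros)
    \<comment> \<open>Scaling towards the origin moves \<open>z\<close> into the open set where the solution is positive.\<close>
    have P: "c *\<^sub>R z \<in> ?P" if c: "0 < c" "c < 1" for c
    proof -
      define \<mu> where "\<mu> = c\<^sup>2"
      have \<mu>: "0 < \<mu>" "\<mu> < 1"
        using c by (auto simp: \<mu>_def abs_square_less_1)
      have a: "ang_sq (c *\<^sub>R z) = \<mu>\<^sup>2 * ang_sq z"
        by (simp add: ang_sq_def \<mu>_def cross_mult_left cross_mult_right power2_eq_square)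
      have d: "defect (c *\<^sub>R z) = 1 - \<mu> * ((norm (fst z))\<^sup>2 + (norm (snd z))\<^sup>2) + \<mu>\<^sup>2 * ang_sq z"
        by (simp add: defect_def a \<mu>_def power_mult_distrib algebra_simps)
      \<comment> \<open>This product is what \<open>d\<close> becomes when the sum of the squared
        norms is replaced by its upper bound \<open>1 + ang_sq z\<close>.\<close>
      have "0 < (1 - \<mu>) * (1 - \<mu> * ang_sq z)"
      proof -
        have "\<mu> * ang_sq z \<le> 1 * ang_sq z"
          using \<mu> by (intro mult_right_mono) auto
        then show ?thesis
          using \<mu> z' \<Gamma> by (intro mult_pos_pos) auto
      qed
      also have "\<dots> = 1 - \<mu> * (1 + ang_sq z) + \<mu>\<^sup>2 * ang_sq z"
        by (simp add: algebra_simps power2_eq_square)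
      also have "\<dots> \<le> defect (c *\<^sub>R z)"
      proof -
        have "(norm (fst z))\<^sup>2 + (norm (snd z))\<^sup>2 \<le> 1 + ang_sq z"
          using z' by (simp add: defect_def)
        then have "\<mu> * ((norm (fst z))\<^sup>2 + (norm (snd z))\<^sup>2) \<le> \<mu> * (1 + ang_sq z)"
          using \<mu> by (intro mult_left_mono) auto
        then show ?thesis
          by (simp add: d)
      qed
      finally have "0 < defect (c *\<^sub>R z)" .
      moreover have "\<mu>\<^sup>2 * ang_sq z < \<Gamma>"
      proof (cases "ang_sq z = 0")
        case False
        then have "0 < ang_sq z"
          using ang_sq_nonneg[of z] by linarith
        moreover have "\<mu>\<^sup>2 < 1"
          using \<mu> by (simp add: abs_square_less_1)
        ultimately have "\<mu>\<^sup>2 * ang_sq z < 1 * ang_sq z"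
          by (intro mult_strict_right_mono)
        then show ?thesis
          using z' by simp
      qed (use \<open>0 < \<Gamma>\<close> in simp)
      ultimately show ?thesis
        by (simp add: a)
    qed
    have "((\<lambda>c. c *\<^sub>R z) \<longlongrightarrow> 1 *\<^sub>R z) (at_left 1)"
      by (intro tendsto_intros)
    then have "\<forall>\<^sub>F c in at_left (1 :: real). c *\<^sub>R z \<in> U"
      using U by (auto dest: topological_tendstoD)
    moreover have "\<forall>\<^sub>F c in at_left (1 :: real). 0 < c \<and> c < 1"
      using eventually_at_left_real[of 0 "1 :: real"] by simp
    ultimately have "\<forall>\<^sub>F c in at_left (1 :: real). c *\<^sub>R z \<in> U \<inter> ?P"
      by eventually_elim (use P in blast)
    then have ne: "U \<inter> ?P \<noteq> {}"
      using eventually_happens[of _ "at_left (1 :: real)"] by fastforce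
    have "AE z in lborel. z \<notin> U \<inter> ?P"
      using ae
    proof eventually_elim
      case (elim z)
      then show ?case
        using ball_solution_pos[OF \<Gamma>, of z] by auto
    qed
    moreover have o: "open (U \<inter> ?P)"
      using U oP by blast
    ultimately have "U \<inter> ?P \<in> null_sets lborel"
      by (subst (asm) AE_iff_null_sets[symmetric]) auto
    then have "negligible (U \<inter> ?P)"
      by (simp add: negligible_iff_null_sets null_sets_completionI)
    then show False
      using open_not_negligible[OF o ne] by simp
  qed
  then have "D \<Gamma> \<subseteq> essential_support ?f"
    unfolding essential_support_def by blast
  ultimately show ?thesis
    by blast
qed

theorem theorem1p2:
  fixes \<Gamma> :: real
  assumes "\<Gamma> \<in> {1 - 1 / 2 ^ 12 ..< 1}"
  shows "D \<Gamma> \<subseteq> {(x, v). norm x \<le> 1 \<and> norm v \<le> 1} \<and>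
    (\<exists>f :: (real ^ 3) \<times> (real ^ 3) \<Rightarrow> real.
       weak_static_solution f \<and>
       essential_support f = D \<Gamma> \<and>
       (AE x in lborel. rho f x = 3 / (4 * pi) * indicator (cball 0 1) x))"
proof -
  have \<Gamma>: "1 - 1 / 2 ^ 12 \<le> \<Gamma>" "\<Gamma> < 1"
    using assms by auto
  have "D \<Gamma> \<subseteq> {(x, v). norm x \<le> 1 \<and> norm v \<le> 1}"
    unfolding D_eq[OF \<Gamma>(2)] using norm_le_1_of_defect(1) \<Gamma> by force
  then show ?thesis
    using weak_static_solution_ball_solution[OF \<Gamma>] essential_support_ball_solution[OF \<Gamma>]
      rho_ball_solution[OF \<Gamma>] by blast
qed

end
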